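(* Let $X$ be a real Banach space, let $I$ be a complex structure on $X$, and let $J$ be a complex structure on a hyperplane $H$ of $X$. Then $\|I_{|H}-J\|_S \geq 2$, where $I_{|H}-J$ is regarded as an operator in $L(H,X)$.
   Context: $L(Y,X)$ is the space of bounded linear operators from $Y$ to $X$. A hyperplane is a closed subspace of codimension $1$. A complex structure on a real Banach space $E$ is a bounded $\mathbb{R}$-linear operator $A:E\to E$ with $A^2=-\mathrm{Id}_E$. Subspaces are closed linear subspaces. For $T\in L(Y,X)$, $\|T\|_S$ is the infimum of those $\varepsilon>0$ such that every infinite dimensional subspace of $Y$ contains a further infinite dimensional subspace $Z$ with $\|T_{|Z}\|\le\varepsilon$. In $I_{|H}-J$, the operator $J:H\to H$ is composed with the inclusion $H\subset X$. *)

theory Defs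
  imports "HOL-Analysis.Analysis"
begin

text \<open>Banach spaces other than the ambient type are represented as closed linear subspaces
  \<open>S :: 'a set\<close> of a Banach space \<open>'a\<close>.  An operator with domain \<open>S\<close> is a total function of
  which only the values on \<open>S\<close> matter; every definition below depends on those values only.\<close>

definition bounded_linear_on :: "'a::real_normed_vector set \<Rightarrow> ('a \<Rightarrow> 'b::real_normed_vector) \<Rightarrow> bool"
  where "bounded_linear_on S f \<longleftrightarrow>
    (\<forall>x\<in>S. \<forall>y\<in>S. f (x + y) = f x + f y) \<and>
    (\<forall>r. \<forall>x\<in>S. f (r *\<^sub>R x) = r *\<^sub>R f x) \<and>
    (\<exists>K. \<forall>x\<in>S. norm (f x) \<le> norm x * K)"

lemma bounded_linear_on_UNIV: "bounded_linear_on UNIV f \<longleftrightarrow> bounded_linear f"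
  unfolding bounded_linear_on_def
  by (auto intro: bounded_linear_intro simp: linear_simps bounded_linear.bounded)

definition closed_subspace :: "'a::real_normed_vector set \<Rightarrow> bool"
  where "closed_subspace S \<longleftrightarrow> subspace S \<and> closed S"

definition infinite_dimensional :: "'a::real_vector set \<Rightarrow> bool"
  where "infinite_dimensional S \<longleftrightarrow> \<not> (\<exists>B. finite B \<and> B \<subseteq> S \<and> S = span B)"

definition hyperplane :: "'a::real_normed_vector set \<Rightarrow> bool"
  where "hyperplane H \<longleftrightarrow> closed_subspace H \<and> (\<exists>v. v \<notin> H \<and> span (insert v H) = UNIV)"

definition complex_structure :: "'a::real_normed_vector set \<Rightarrow> ('a \<Rightarrow> 'a) \<Rightarrow> bool"
  where "complex_structure E A \<longleftrightarrow>
    bounded_linear_on E A \<and> A ` E \<subseteq> E \<and> (\<forall>x\<in>E. A (A x) = - x)"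

text \<open>Norm of the restriction of \<open>f\<close> to \<open>Z\<close>.  As in the library's \<^const>\<open>onorm\<close>, the quotient
  is \<open>0\<close> at \<open>x = 0\<close>.\<close>

definition onorm_on :: "'a::real_normed_vector set \<Rightarrow> ('a \<Rightarrow> 'b::real_normed_vector) \<Rightarrow> real"
  where "onorm_on Z f = (SUP x\<in>Z. norm (f x) / norm x)"

lemma onorm_on_UNIV: "onorm_on UNIV f = onorm f"
  by (simp add: onorm_on_def onorm_def)

definition S_admissible :: "'a::real_normed_vector set \<Rightarrow> ('a \<Rightarrow> 'b::real_normed_vector) \<Rightarrow> real \<Rightarrow> bool"
  where "S_admissible Y T \<epsilon> \<longleftrightarrow>
    (\<forall>W. closed_subspace W \<and> infinite_dimensional W \<and> W \<subseteq> Y \<longrightarrow>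
      (\<exists>Z. closed_subspace Z \<and> infinite_dimensional Z \<and> Z \<subseteq> W \<and> onorm_on Z T \<le> \<epsilon>))"

definition S_seminorm :: "'a::real_normed_vector set \<Rightarrow> ('a \<Rightarrow> 'b::real_normed_vector) \<Rightarrow> real"
  where "S_seminorm Y T = Inf {\<epsilon>. \<epsilon> > 0 \<and> S_admissible Y T \<epsilon>}"

text \<open>For bounded \<open>T\<close> the infimum is over a nonempty set bounded below, so it is never an
  arbitrary value of \<^const>\<open>Inf\<close>.\<close>

lemma S_admissible_exists:
  assumes "bounded_linear_on Y T"
  shows "\<exists>\<epsilon>>0. S_admissible Y T \<epsilon>"
proof -
  from assms obtain K where K: "\<And>x. x \<in> Y \<Longrightarrow> norm (T x) \<le> norm x * K"
    unfolding bounded_linear_on_def by blast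
  have q: "norm (T x) / norm x \<le> max K 1" if "x \<in> Y" for x
  proof (cases "x = 0")
    case False
    then have "norm (T x) / norm x \<le> K"
      using K[OF that] by (simp add: divide_le_eq mult.commute)
    then show ?thesis by simp
  qed simp
  have "onorm_on W T \<le> max K 1" if "closed_subspace W" "W \<subseteq> Y" for W
    unfolding onorm_on_def
  proof (rule cSUP_least)
    show "W \<noteq> {}"
      using that(1) subspace_0 unfolding closed_subspace_def by blast
  qed (use q that(2) in blast)
  then have "S_admissible Y T (max K 1)"
    unfolding S_admissible_def by blast
  then show ?thesis by (intro exI[of _ "max K 1"]) simp
qed

end

theory Submission
  imports Defs
begin

text \<open>Suppose the seminorm is smaller than \<open>2\<close>.  Then \<open>(2 - s) I + s J\<close> is an upper semi-Fredholm
  operator from \<open>H\<close> to \<open>X\<close> for all \<open>s \<in> [0, 1]\<close>: otherwise \<open>(2 - s) I + s J\<close> is almost \<open>0\<close> on some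
  infinite dimensional \<open>Z\<close>, hence \<open>s (I - J)\<close> is almost \<open>2 I\<close> on \<open>Z\<close> and \<open>(2 - s) (I - J)\<close> is almost
  \<open>2 I\<close> on \<open>I Z\<close>; as \<open>I\<^sup>2 = - Id\<close>, this contradicts \<open>s (2 - s) \<le> 1\<close>.  The index is constant along
  this path, and it is \<open>- 1\<close> at \<open>s = 0\<close>.  But \<open>I + J\<close> satisfies \<open>I (I + J) = (I + J) J\<close>, so it is
  complex linear and its real index is even.  Extending all operators by \<open>0\<close> along a vector
  outside \<open>H\<close> turns index \<open>- 1\<close> into index \<open>0\<close>, which can be expressed without dimensions:
  a finite rank perturbation is invertible.\<close>

section \<open>The Hahn-Banach theorem\<close>

text \<open>Homogeneity is asked only as an inequality for positive scalars: this form is easy to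
  check for infima, and \<open>sublinear_scale\<close> recovers equality.\<close>

definition sublinear :: "('a::real_vector \<Rightarrow> real) \<Rightarrow> bool"
  where "sublinear p \<longleftrightarrow>
    (\<forall>x y. p (x + y) \<le> p x + p y) \<and> (\<forall>c>0. \<forall>x. p (c *\<^sub>R x) \<le> c * p x)"

lemma sublinear_add: "sublinear p \<Longrightarrow> p (x + y) \<le> p x + p y"
  by (simp add: sublinear_def)

lemma sublinear_0:
  assumes "sublinear p"
  shows "p 0 = 0"
proof -
  have "p (c *\<^sub>R 0) \<le> c * p 0" if "c > 0" for c
    using assms that unfolding sublinear_def by blast
  from this[of 2] this[of "1/2"] show ?thesis by simp
qed

lemma sublinear_scale:
  assumes "sublinear p" "c \<ge> 0"
  shows "p (c *\<^sub>R x) = c * p x"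
proof (cases "c = 0")
  case True
  then show ?thesis using sublinear_0[OF assms(1)] by simp
next
  case False
  then have c: "c > 0" using assms(2) by simp
  have le: "p (d *\<^sub>R y) \<le> d * p y" if "d > 0" for d y
    using assms(1) that unfolding sublinear_def by blast
  have "p ((1/c) *\<^sub>R (c *\<^sub>R x)) \<le> (1/c) * p (c *\<^sub>R x)"
    using c by (intro le) simp
  then have "c * p x \<le> p (c *\<^sub>R x)"
    using c by (simp add: field_simps)
  with le[OF c, of x] show ?thesis by simp
qed

lemma sublinear_minus: "sublinear p \<Longrightarrow> - p (- x) \<le> p x"
  using sublinear_add[of p x "- x"] sublinear_0[of p] by simp

lemma sublinear_norm: "sublinear (norm :: 'a::real_normed_vector \<Rightarrow> real)"
  by (simp add: sublinear_def norm_triangle_ineq)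

text \<open>The witness is the infimum over t >= 0 of p(x + t u) - t p(u): t = 0 gives
  \<open>p' x \<le> p x\<close> and t = 1 gives the bound at \<open>- u\<close>. It serves both for
  the linearity of minimal functionals and for norming functionals.\<close>

lemma sublinear_shrink:
  assumes p: "sublinear p"
  obtains p' where "sublinear p'" "\<And>x. p' x \<le> p x" "p' (- u) \<le> - p u"
proof -
  define g where "g x t = p (x + t *\<^sub>R u) - t * p u" for x t
  define p' where "p' x = (INF t\<in>{0..}. g x t)" for x
  \<comment> \<open>The bound does not depend on \<open>t\<close>, so the infimum is over a set
    bounded below.\<close>
  have lower: "- p (- x) \<le> g x t" if "t \<ge> 0" for x t
    using sublinear_add[OF p, of "x + t *\<^sub>R u" "- x"] sublinear_scale[OF p that, of u]
    unfolding g_def by simp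
  have upper: "p' x \<le> g x t" if "t \<ge> 0" for x t
    unfolding p'_def using that lower by (intro cINF_lower bdd_belowI2[where m = "- p (- x)"]) auto
  have greatest: "m \<le> p' x" if "\<And>t. t \<ge> 0 \<Longrightarrow> m \<le> g x t" for m x
    unfolding p'_def using that by (intro cINF_greatest) auto
  have "p' (x + y) \<le> p' x + p' y" for x y
  proof -
    have gxy: "p' (x + y) \<le> g x s + g y t" if "s \<ge> 0" "t \<ge> 0" for s t
    proof -
      have "p' (x + y) \<le> g (x + y) (s + t)" using that by (intro upper) simp
      also have "\<dots> \<le> g x s + g y t"
        using sublinear_add[OF p, of "x + s *\<^sub>R u" "y + t *\<^sub>R u"]
        by (simp add: g_def algebra_simps)
      finally show ?thesis .
    qed
    have "p' (x + y) - g x s \<le> p' y" if "s \<ge> 0" for s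
      using gxy[OF that] by (intro greatest) (simp add: algebra_simps)
    then have "p' (x + y) - p' y \<le> p' x"
      by (intro greatest) (simp add: algebra_simps)
    then show ?thesis by simp
  qed
  moreover have "p' (c *\<^sub>R x) \<le> c * p' x" if c: "c > 0" for c x
  proof -
    have "p' (c *\<^sub>R x) / c \<le> g x t" if "t \<ge> 0" for t
    proof -
      have "p' (c *\<^sub>R x) \<le> g (c *\<^sub>R x) (c * t)" using c that by (intro upper) simp
      also have "\<dots> = c * g x t"
        using sublinear_scale[OF p, of c "x + t *\<^sub>R u"] c by (simp add: g_def algebra_simps)
      finally show ?thesis using c by (simp add: field_simps)
    qed
    then have "p' (c *\<^sub>R x) / c \<le> p' x" by (rule greatest)
    then show ?thesis using c by (simp add: field_simps)
  qed
  ultimately have "sublinear p'" by (simp add: sublinear_def)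
  moreover have "p' x \<le> p x" for x using upper[of 0 x] by (simp add: g_def)
  moreover have "p' (- u) \<le> - p u"
    using upper[of 1 "- u"] sublinear_0[OF p] by (simp add: g_def)
  ultimately show ?thesis by (rule that)
qed

text \<open>Shrinking leaves a minimal \<open>m\<close> unchanged, hence \<open>m\<close> is odd;
  oddness turns subadditivity into additivity.\<close>

lemma sublinear_minimal_linear:
  assumes m: "sublinear m" and min: "\<And>p. sublinear p \<Longrightarrow> (\<And>x. p x \<le> m x) \<Longrightarrow> p = m"
  shows "linear m"
proof -
  have neg: "m (- u) = - m u" for u
  proof -
    obtain p' where p': "sublinear p'" "\<And>x. p' x \<le> m x" "p' (- u) \<le> - m u"
      using sublinear_shrink[OF m] by blast
    then have "p' = m" by (intro min) auto
    then show ?thesis using p'(3) sublinear_minus[OF m, of u] by simp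
  qed
  have "m (x + y) = m x + m y" for x y
    using sublinear_add[OF m, of x y] sublinear_add[OF m, of "x + y" "- y"] neg[of y] by simp
  moreover have "m (c *\<^sub>R x) = c * m x" for c x
  proof (cases "c \<ge> 0")
    case True
    then show ?thesis by (rule sublinear_scale[OF m])
  next
    case False
    then show ?thesis using sublinear_scale[OF m, of "- c" x] neg[of "c *\<^sub>R x"] by simp
  qed
  ultimately show ?thesis by (intro linearI) auto
qed

text \<open>Subadditivity of the infimum involves two members \<open>p\<close> and
  \<open>p'\<close>; the chain condition supplies a member \<open>r\<close> below both, and
  \<open>r\<close> is subadditive.\<close>

lemma sublinear_INF_chain:
  assumes "C \<noteq> {}" and sub: "\<And>p. p \<in> C \<Longrightarrow> sublinear p"
    and chain: "\<And>p p'. p \<in> C \<Longrightarrow> p' \<in> C \<Longrightarrow> p \<le> p' \<or> p' \<le> p"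
    and bdd: "\<And>x. bdd_below ((\<lambda>p. p x) ` C)"
  shows "sublinear (\<lambda>x. INF p\<in>C. p x)" (is "sublinear ?m")
proof -
  have lower: "?m x \<le> p x" if "p \<in> C" for p x
    using bdd that by (intro cINF_lower) auto
  have greatest: "k \<le> ?m x" if "\<And>p. p \<in> C \<Longrightarrow> k \<le> p x" for k x
    using assms(1) that by (intro cINF_greatest) auto
  have "?m (x + y) \<le> ?m x + ?m y" for x y
  proof -
    have pp: "?m (x + y) \<le> p x + p' y" if pC: "p \<in> C" "p' \<in> C" for p p'
    proof -
      obtain r where r: "r \<in> C" "r \<le> p" "r \<le> p'"
        using chain[OF pC] pC by blast
      have "?m (x + y) \<le> r (x + y)" by (rule lower[OF r(1)])
      also have "\<dots> \<le> r x + r y" by (rule sublinear_add[OF sub[OF r(1)]])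
      also have "\<dots> \<le> p x + p' y" using r by (intro add_mono) (auto simp: le_fun_def)
      finally show ?thesis .
    qed
    have "?m (x + y) - p x \<le> ?m y" if "p \<in> C" for p
      using pp[OF that] by (intro greatest) (simp add: algebra_simps)
    then have "?m (x + y) - ?m y \<le> ?m x"
      by (intro greatest) (simp add: algebra_simps)
    then show ?thesis by simp
  qed
  moreover have "?m (c *\<^sub>R x) \<le> c * ?m x" if c: "c > 0" for c x
  proof -
    have "?m (c *\<^sub>R x) / c \<le> p x" if "p \<in> C" for p
      using lower[OF that, of "c *\<^sub>R x"] sublinear_scale[OF sub[OF that], of c x] c
      by (simp add: field_simps)
    then have "?m (c *\<^sub>R x) / c \<le> ?m x" by (rule greatest)
    then show ?thesis using c by (simp add: field_simps)
  qed
  ultimately show ?thesis by (simp add: sublinear_def)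
qed

lemma sublinear_dominates_linear:
  assumes q: "sublinear q"
  obtains f where "linear f" "\<And>x. f x \<le> q x"
proof -
  define A where "A = {p. sublinear p \<and> p \<le> q}"
  have "\<exists>m\<in>A. \<forall>p\<in>A. p \<le> m \<longrightarrow> p = m"
  \<comment> \<open>The order is reversed, so Zorn's lemma yields a minimal sublinear functional
    below \<open>q\<close>.\<close>
  proof (rule predicate_Zorn)
    show "partial_order_on A (relation_of (\<lambda>m p. p \<le> m) A)"
      unfolding relation_of_def
      by (auto simp: partial_order_on_def preorder_on_def refl_on_def trans_def antisym_def)
    fix C assume C: "C \<in> Chains (relation_of (\<lambda>m p. p \<le> m) A)"
    show "\<exists>u\<in>A. \<forall>a\<in>C. u \<le> a"
    proof (cases "C = {}")
      case True
      then show ?thesis using q by (auto simp: A_def)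
    next
      case False
      have CA: "C \<subseteq> A" and chain: "p \<le> p' \<or> p' \<le> p" if "p \<in> C" "p' \<in> C" for p p'
        using C that by (auto simp: Chains_def relation_of_def)
      then have sub: "sublinear p" "p \<le> q" if "p \<in> C" for p
        using that by (auto simp: A_def)
      \<comment> \<open>A lower bound common to the whole chain, which makes the pointwise infimum
        meaningful.\<close>
      have "- q (- x) \<le> p x" if "p \<in> C" for p x
        using sub(2)[OF that, THEN le_funD, of "- x"] sublinear_minus[OF sub(1)[OF that], of x]
        by simp
      then have bdd: "bdd_below ((\<lambda>p. p x) ` C)" for x
        by (intro bdd_belowI2)
      define u where "u x = (INF p\<in>C. p x)" for x
      have lower: "u \<le> p" if "p \<in> C" for p
        unfolding u_def le_fun_def using bdd that by (auto intro: cINF_lower)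
      have "sublinear u"
        unfolding u_def using False sub chain bdd by (intro sublinear_INF_chain) auto
      moreover have "u \<le> q" using False lower sub(2) by (meson ex_in_conv order_trans)
      ultimately show ?thesis using lower by (auto simp: A_def)
    qed
  qed
  then obtain m where m: "sublinear m" "m \<le> q"
    and min: "\<And>p. sublinear p \<Longrightarrow> p \<le> q \<Longrightarrow> p \<le> m \<Longrightarrow> p = m"
    by (auto simp: A_def)
  have "linear m"
    using m(1)
  proof (rule sublinear_minimal_linear)
    show "p = m" if "sublinear p" "\<And>x. p x \<le> m x" for p
      using that m(2) by (intro min) (auto simp: le_fun_def intro: order_trans)
  qed
  then show ?thesis using m(2) by (intro that[of m]) (auto simp: le_fun_def)
qed

text \<open>The norm is first shrunk in the direction \<open>x\<close>; a linear functional below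
  the result is at most \<open>- norm x\<close> at \<open>- x\<close>, which forces equality at
  \<open>x\<close>.\<close>

lemma norming_functional:
  fixes x :: "'a::real_normed_vector"
  obtains f where "linear f" "f x = norm x" "\<And>y. \<bar>f y\<bar> \<le> norm y"
proof -
  obtain p where p: "sublinear p" "\<And>y. p y \<le> norm y" "p (- x) \<le> - norm x"
    using sublinear_shrink[OF sublinear_norm] by blast
  obtain f where f: "linear f" "\<And>y. f y \<le> p y"
    using sublinear_dominates_linear[OF p(1)] by blast
  have neg: "f (- y) = - f y" for y using f(1) by (rule linear_neg)
  have le: "f y \<le> norm y" for y using f(2)[of y] p(2)[of y] by simp
  have "f x = norm x" using f(2)[of "- x"] p(3) neg[of x] le[of x] by simp
  moreover have "\<bar>f y\<bar> \<le> norm y" for y using le[of y] le[of "- y"] neg[of y] by simp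
  ultimately show ?thesis using f(1) that by blast
qed

section \<open>Operators that are not upper semi-Fredholm\<close>

lemma span_range_nat_sum:
  assumes "y \<in> span (range x)"
  obtains a N where "y = (\<Sum>i<(N::nat). a i *\<^sub>R x i)"
proof -
  \<comment> \<open>Coefficients vanish from \<open>N\<close> on, so combinations of different
    lengths can be padded and added.\<close>
  define S where "S = {y. \<exists>a N. (\<forall>i\<ge>N. a i = 0) \<and> y = (\<Sum>i<(N::nat). a i *\<^sub>R x i)}"
  have pad: "(\<Sum>i<M. a i *\<^sub>R x i) = (\<Sum>i<N. a i *\<^sub>R x i)" if "N \<le> M" "\<forall>i\<ge>N. a i = 0" for a and M N :: nat
    using that by (intro sum.mono_neutral_right) auto
  have "subspace S"
  proof (rule subspaceI)
    show "0 \<in> S" unfolding S_def by (auto intro!: exI[of _ "\<lambda>_. 0"])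
  next
    fix y z assume "y \<in> S" "z \<in> S"
    then obtain a N b M where a: "\<forall>i\<ge>N. a i = 0" "y = (\<Sum>i<N. a i *\<^sub>R x i)"
      and b: "\<forall>i\<ge>M. b i = 0" "z = (\<Sum>i<M. b i *\<^sub>R x i)"
      unfolding S_def by blast
    have "y + z = (\<Sum>i<max N M. (a i + b i) *\<^sub>R x i)"
      using pad[of N "max N M" a] pad[of M "max N M" b] a b
      by (simp add: scaleR_left_distrib sum.distrib)
    then show "y + z \<in> S" unfolding S_def
      using a(1) b(1) by (auto intro!: exI[of _ "\<lambda>i. a i + b i"] exI[of _ "max N M"])
  next
    fix c y assume "y \<in> S"
    then obtain a N where a: "\<forall>i\<ge>N. a i = 0" "y = (\<Sum>i<N. a i *\<^sub>R x i)"
      unfolding S_def by blast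
    then show "c *\<^sub>R y \<in> S" unfolding S_def
      by (auto simp: scaleR_right.sum intro!: exI[of _ "\<lambda>i. c * a i"] exI[of _ N])
  qed
  moreover have "x n \<in> S" for n
    unfolding S_def by (auto intro!: exI[of _ "\<lambda>i. if i = n then 1 else 0"] exI[of _ "Suc n"]
        simp: if_distrib[of "\<lambda>c. c *\<^sub>R _"] cong: if_cong)
  ultimately have "span (range x) \<subseteq> S" by (intro span_minimal) auto
  with assms show ?thesis using that unfolding S_def by blast
qed

text \<open>Bounded below on a closed subspace of finite codimension, given as a common kernel. For
  bounded operators between Banach spaces this amounts to a finite dimensional kernel and a closed
  range.\<close>

definition upper_semi_fredholm :: "('a::real_normed_vector \<Rightarrow> 'b::real_normed_vector) \<Rightarrow> bool"
  where "upper_semi_fredholm B \<longleftrightarrow> (\<exists>F :: ('a \<Rightarrow> real) set. \<exists>c>0.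
    finite F \<and> (\<forall>f\<in>F. bounded_linear f) \<and> (\<forall>x. (\<forall>f\<in>F. f x = 0) \<longrightarrow> c * norm x \<le> norm (B x)))"

text \<open>A substitute for a basic sequence: \<open>f n\<close> norms \<open>x n\<close> and
  annihilates all later vectors, so coefficients can be read off one after another.\<close>

locale triangular_system =
  fixes x :: "nat \<Rightarrow> 'a::real_normed_vector" and f :: "nat \<Rightarrow> 'a \<Rightarrow> real"
  assumes norm_x: "norm (x n) = 1" and linear_f: "linear (f n)" and f_le: "\<bar>f n y\<bar> \<le> norm y"
    and f_diag: "f n (x n) = 1" and f_upper: "n < m \<Longrightarrow> f n (x m) = 0"
begin

text \<open>Applying \<open>f n\<close> removes the terms after \<open>n\<close> and expresses
  \<open>a n\<close> by the earlier coefficients; the induction closes because 1 + (1 + 2 + ... +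
  2^(n-1)) = 2^n.\<close>

lemma coefficient_bound:
  assumes "n < N"
  shows "\<bar>a n\<bar> \<le> 2 ^ n * norm (\<Sum>i<N. a i *\<^sub>R x i)"
  using assms
proof (induction n rule: less_induct)
  case (less n)
  let ?y = "\<Sum>i<N. a i *\<^sub>R x i"
  have "f n ?y = (\<Sum>i<N. a i * f n (x i))"
    by (simp add: linear_sum[OF linear_f] linear_cmul[OF linear_f])
  also have "\<dots> = (\<Sum>i<Suc n. a i * f n (x i))"
    using less.prems by (intro sum.mono_neutral_right) (auto simp: f_upper)
  finally have "a n = f n ?y - (\<Sum>i<n. a i * f n (x i))" by (simp add: f_diag)
  then have "\<bar>a n\<bar> \<le> \<bar>f n ?y\<bar> + (\<Sum>i<n. \<bar>a i * f n (x i)\<bar>)"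
    using sum_abs[of "\<lambda>i. a i * f n (x i)" "{..<n}"] by linarith
  also have "\<dots> \<le> norm ?y + (\<Sum>i<n. 2 ^ i * norm ?y)"
  proof (intro add_mono f_le sum_mono)
    fix i assume "i \<in> {..<n}"
    then have "\<bar>a i\<bar> \<le> 2 ^ i * norm ?y" using less by auto
    moreover have "\<bar>f n (x i)\<bar> \<le> 1" using f_le[of n "x i"] by (simp add: norm_x)
    ultimately have "\<bar>a i\<bar> * \<bar>f n (x i)\<bar> \<le> (2 ^ i * norm ?y) * 1" by (intro mult_mono) auto
    then show "\<bar>a i * f n (x i)\<bar> \<le> 2 ^ i * norm ?y" by (simp add: abs_mult)
  qed
  also have "\<dots> = 2 ^ n * norm ?y"
    by (simp add: sum_distrib_right[symmetric] sum_gp_strict algebra_simps)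
  finally show ?case .
qed

text \<open>Blocks grow at the front: \<open>f N\<close> annihilates the span of the later vectors
  but not \<open>x N\<close>. Arbitrarily large blocks exclude a finite spanning set.\<close>

lemma independent_block: "independent (x ` {N..<N + k}) \<and> card (x ` {N..<N + k}) = k"
proof (induction k arbitrary: N)
  case (Suc k)
  have "span (x ` {Suc N..<Suc N + k}) \<subseteq> {y. f N y = 0}"
    by (intro span_minimal linear_subspace_kernel linear_f) (auto simp: f_upper)
  then have notin: "x N \<notin> span (x ` {Suc N..<Suc N + k})" using f_diag[of N] by auto
  have "{N..<N + Suc k} = insert N {Suc N..<Suc N + k}" by auto
  then have eq: "x ` {N..<N + Suc k} = insert (x N) (x ` {Suc N..<Suc N + k})" by simp
  have notin': "x N \<notin> x ` {Suc N..<Suc N + k}" using notin span_base[of "x N"] by metis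
  show ?case
    unfolding eq using Suc.IH[of "Suc N"] notin notin' by (auto simp: independent_insert)
qed (simp add: independent_empty)

lemma infinite_dimensional_closure_span: "infinite_dimensional (closure (span (range x)))"
  unfolding infinite_dimensional_def
proof
  assume "\<exists>B. finite B \<and> B \<subseteq> closure (span (range x)) \<and> closure (span (range x)) = span B"
  then obtain B where B: "finite B" "closure (span (range x)) = span B" by blast
  have "x ` {0..<0 + Suc (card B)} \<subseteq> span B"
    using closure_subset[of "span (range x)"] span_superset[of "range x"] B(2) by blast
  from independent_span_bound[OF B(1) _ this] independent_block[of 0 "Suc (card B)"]
  show False by simp
qed

end

lemma closed_zero_set: "bounded_linear (g :: _ \<Rightarrow> real) \<Longrightarrow> closed {x. g x = 0}"
  by (intro closed_Collect_eq continuous_intros linear_continuous_on)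

lemma subspace_closure:
  fixes S :: "'a::real_normed_vector set"
  assumes S: "subspace S"
  shows "subspace (closure S)"
proof (rule subspaceI)
  show "0 \<in> closure S" using subspace_0[OF S] closure_subset by blast
  show "x + y \<in> closure S" if xy: "x \<in> closure S" "y \<in> closure S" for x y
  proof -
    obtain u w where "\<forall>n. u n \<in> S" "u \<longlonglongrightarrow> x" "\<forall>n. w n \<in> S" "w \<longlonglongrightarrow> y"
      using xy unfolding closure_sequential by blast
    then show ?thesis
      unfolding closure_sequential
      by (intro exI[of _ "\<lambda>n. u n + w n"]) (auto intro: tendsto_add subspace_add[OF S])
  qed
  show "c *\<^sub>R x \<in> closure S" if x: "x \<in> closure S" for c x
  proof -
    obtain u where "\<forall>n. u n \<in> S" "u \<longlonglongrightarrow> x"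
      using x unfolding closure_sequential by blast
    then show ?thesis
      unfolding closure_sequential
      by (intro exI[of _ "\<lambda>n. c *\<^sub>R u n"]) (auto intro: tendsto_intros subspace_scale[OF S])
  qed
qed

text \<open>No finite set of functionals makes \<open>B\<close> bounded below on its common kernel.
  So unit vectors can be chosen successively, annihilated by \<open>F\<close> and by the norming
  functionals of their predecessors, with rapidly decreasing images; \<open>Z\<close> is their
  closed span.\<close>

lemma not_upper_semi_fredholm_small_subspace:
  fixes B :: "'a::real_normed_vector \<Rightarrow> 'b::real_normed_vector" and F :: "('a \<Rightarrow> real) set"
  assumes B: "bounded_linear B" and sing: "\<not> upper_semi_fredholm B"
    and F: "finite F" "\<And>f. f \<in> F \<Longrightarrow> bounded_linear f" and \<delta>: "\<delta> > 0"
  obtains Z where "closed_subspace Z" "infinite_dimensional Z"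
    "\<And>z f. z \<in> Z \<Longrightarrow> f \<in> F \<Longrightarrow> f z = 0" "\<And>z. z \<in> Z \<Longrightarrow> norm (B z) \<le> \<delta> * norm z"
proof -
  interpret B: bounded_linear B by fact
  \<comment> \<open>\<open>r\<close> pairs a vector with its norming functional. The decay
    \<open>4 ^ n\<close> beats the coefficient bound \<open>2 ^ n\<close>; the remaining sum of
    powers of 1/2 stays below 2, whence the factor \<open>\<delta> / 2\<close>.\<close>
  define P where "P h n r \<longleftrightarrow> norm (fst r) = 1 \<and> linear (snd r) \<and> (\<forall>y. \<bar>snd r y\<bar> \<le> norm y) \<and>
    snd r (fst r) = 1 \<and> (\<forall>g\<in>F. g (fst r) = 0) \<and> (\<forall>m<n. snd (h m) (fst r) = 0) \<and>
    norm (B (fst r)) \<le> \<delta> / 2 / 4 ^ n"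
    for h :: "nat \<Rightarrow> 'a \<times> ('a \<Rightarrow> real)" and n r
  have "\<exists>h. \<forall>n. P h n (h n)"
  proof (rule dependent_wellorder_choice)
    fix n h assume h: "\<And>m. m < n \<Longrightarrow> P h m (h m)"
    let ?G = "F \<union> (snd \<circ> h) ` {..<n}"
    have "bounded_linear (snd (h m))" if "m < n" for m
      using h[OF that] linear_conv_bounded_linear
      unfolding P_def bounded_linear_def bounded_linear_axioms_def
      by (auto intro!: exI[of _ 1])
    then have "\<forall>f\<in>?G. bounded_linear f" using F(2) by auto
    moreover have "finite ?G" using F(1) by auto
    moreover have "\<delta> / 2 / 4 ^ n > 0" using \<delta> by simp
    ultimately obtain u where u: "\<And>f. f \<in> ?G \<Longrightarrow> f u = 0" "norm (B u) < \<delta> / 2 / 4 ^ n * norm u"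
      using sing unfolding upper_semi_fredholm_def by (meson not_le)
    have u0: "u \<noteq> 0" using u(2) by (auto simp: B.zero)
    define x where "x = u /\<^sub>R norm u"
    have nx: "norm x = 1" using u0 by (simp add: x_def)
    obtain f where f: "linear f" "f x = norm x" "\<And>y. \<bar>f y\<bar> \<le> norm y"
      using norming_functional by blast
    have zero: "g x = 0" if "linear g" "g u = 0" for g :: "'a \<Rightarrow> real"
      using that by (simp add: x_def linear_cmul)
    have "norm (B x) \<le> \<delta> / 2 / 4 ^ n"
      using u(2) u0 by (simp add: x_def B.scaleR field_simps)
    moreover have "g x = 0" if "g \<in> F" for g
      using zero[of g] F(2)[OF that] u(1) that by (auto simp: bounded_linear.linear)
    moreover have "snd (h m) x = 0" if "m < n" for m
      using zero[of "snd (h m)"] h[OF that] u(1) that by (auto simp: P_def)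
    ultimately have "P h n (x, f)" using f nx by (simp add: P_def)
    then show "\<exists>r. P h n r" by blast
  qed (auto simp: P_def)
  then obtain h where h: "\<And>n. P h n (h n)" by blast
  define x where "x n = fst (h n)" for n
  define f where "f n = snd (h n)" for n
  interpret triangular_system x f
    by (rule triangular_system.intro; unfold x_def f_def) (use h[unfolded P_def] in blast)+
  let ?Z = "closure (span (range x))"
  have small: "norm (B y) \<le> \<delta> * norm y" if "y \<in> span (range x)" for y
  proof -
    obtain a N where y: "y = (\<Sum>i<N. a i *\<^sub>R x i)" using span_range_nat_sum[OF \<open>y \<in> _\<close>] by blast
    have "norm (B y) \<le> (\<Sum>i<N. norm (a i *\<^sub>R B (x i)))"
      unfolding y by (simp add: B.sum B.scaleR norm_sum del: norm_scaleR)
    also have "\<dots> \<le> (\<Sum>i<N. (2 ^ i * norm y) * (\<delta> / 2 / 4 ^ i))"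
    proof (rule sum_mono)
      fix i assume "i \<in> {..<N}"
      then have "\<bar>a i\<bar> \<le> 2 ^ i * norm y" using coefficient_bound[of i N a] y by simp
      moreover have "norm (B (x i)) \<le> \<delta> / 2 / 4 ^ i" using h[of i] by (simp add: P_def x_def)
      ultimately have "\<bar>a i\<bar> * norm (B (x i)) \<le> (2 ^ i * norm y) * (\<delta> / 2 / 4 ^ i)"
        by (intro mult_mono) auto
      then show "norm (a i *\<^sub>R B (x i)) \<le> (2 ^ i * norm y) * (\<delta> / 2 / 4 ^ i)" by simp
    qed
    also have "\<dots> = \<delta> * norm y * (\<Sum>i<N. (1/2) ^ i) / 2"
      unfolding sum_distrib_left sum_divide_distrib
      by (intro sum.cong) (simp_all add: field_simps power_mult_distrib[symmetric] flip: power_mult_distrib)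
    also have "\<dots> = \<delta> * norm y * (1 - (1/2) ^ N)"
      by (simp add: sum_gp_strict)
    also have "\<dots> \<le> \<delta> * norm y * 1" using \<delta> by (intro mult_left_mono) auto
    finally show ?thesis by simp
  qed
  have "closed {y. norm (B y) \<le> \<delta> * norm y}"
    by (intro closed_Collect_le continuous_intros linear_continuous_on B)
  then have "?Z \<subseteq> {y. norm (B y) \<le> \<delta> * norm y}"
    using small by (intro closure_minimal) auto
  moreover have "?Z \<subseteq> {y. g y = 0}" if "g \<in> F" for g
  proof (intro closure_minimal span_minimal)
    show "range x \<subseteq> {y. g y = 0}" using h that by (auto simp: P_def x_def)
    show "subspace {y. g y = 0}"
      using F(2)[OF that] by (auto simp: subspace_def linear_simps)
  qed (use F(2)[OF that] closed_zero_set in auto)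
  moreover have "closed_subspace ?Z"
    by (simp add: closed_subspace_def subspace_closure)
  ultimately show ?thesis
    using infinite_dimensional_closure_span that[of ?Z] by auto
qed

section \<open>Operators of index zero\<close>

definition finite_rank :: "('a::real_vector \<Rightarrow> 'b::real_vector) \<Rightarrow> bool"
  where "finite_rank K \<longleftrightarrow> linear K \<and> (\<exists>S. finite S \<and> range K \<subseteq> span S)"

section \<open>Finite rank maps and the Fredholm alternative\<close>

lemma finite_rank_zero: "finite_rank (\<lambda>_. 0)"
  by (auto simp: finite_rank_def linear_zero intro!: exI[of _ "{}"])

lemma finite_rank_rank_one: "linear f \<Longrightarrow> finite_rank (\<lambda>x. f x *\<^sub>R y)"
  by (auto simp: finite_rank_def span_base span_scale linear_add linear_cmul scaleR_left_distrib
      intro!: exI[of _ "{y}"] linearI)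

lemma finite_rank_add:
  assumes "finite_rank K" "finite_rank K'"
  shows "finite_rank (\<lambda>x. K x + K' x)"
proof -
  obtain S T where S: "finite S" "range K \<subseteq> span S" and T: "finite T" "range K' \<subseteq> span T"
    using assms by (auto simp: finite_rank_def)
  have "K x + K' x \<in> span (S \<union> T)" for x
    using S(2) T(2) span_mono[of S "S \<union> T"] span_mono[of T "S \<union> T"] by (auto intro!: span_add)
  then show ?thesis
    using assms S(1) T(1) by (auto simp: finite_rank_def linear_compose_add intro!: exI[of _ "S \<union> T"])
qed

lemma finite_rank_diff:
  assumes "finite_rank K" "finite_rank K'"
  shows "finite_rank (\<lambda>x. K x - K' x)"
proof -
  have "finite_rank (\<lambda>x. - K' x)"
    using assms(2) unfolding finite_rank_def
    by (fastforce simp: linear_compose_neg intro: span_neg)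
  from finite_rank_add[OF assms(1) this] show ?thesis by simp
qed

text \<open>Dimension count: a basis \<open>C\<close> goes to an independent set of the same size,
  and a missed vector would enlarge it beyond what \<open>span C\<close> admits.\<close>

lemma inj_on_imp_surj_span:
  assumes T: "linear T" and B: "finite B" and inv: "T ` span B \<subseteq> span B" and inj: "inj_on T (span B)"
  shows "T ` span B = span B"
proof -
  obtain C where C: "C \<subseteq> B" "independent C" "B \<subseteq> span C"
    using maximal_independent_subset[of B] by blast
  have spanC: "span C = span B" using C by (metis span_mono span_span subset_antisym)
  have fin: "finite C" using C(1) B finite_subset by blast
  have indep: "independent (T ` C)"
    using linear_independent_injective_image[OF T C(2)] inj spanC by simp
  have card: "card (T ` C) = card C"
    using inj spanC span_superset[of C] by (metis card_image inj_on_subset)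
  have TC: "T ` C \<subseteq> span C" using inv spanC span_superset[of C] by blast
  have "x \<in> span (T ` C)" if "x \<in> span C" for x
  proof (rule ccontr)
    assume x: "x \<notin> span (T ` C)"
    then have "x \<notin> T ` C" using span_base[of x] by metis
    moreover have "independent (insert x (T ` C))"
      using indep x by (simp add: independent_insert)
    ultimately show False
      using independent_span_bound[OF fin, of "insert x (T ` C)"] TC that card fin by simp
  qed
  moreover have "span (T ` C) = T ` span C" by (rule linear_span_image[OF T])
  ultimately show ?thesis using inv spanC by blast
qed

text \<open>For the converse, a right inverse \<open>g\<close> is injective on the span, hence onto
  it, so \<open>T\<close> is a two-sided inverse there.\<close>

lemma inj_on_iff_surj_span:
  assumes T: "linear T" and B: "finite B" and inv: "T ` span B \<subseteq> span B"
  shows "inj_on T (span B) \<longleftrightarrow> T ` span B = span B"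
proof
  assume surj: "T ` span B = span B"
  obtain g where g: "range g \<subseteq> span B" "linear g" "\<And>v. v \<in> span B \<Longrightarrow> T (g v) = v"
    using linear_exists_right_inverse_on[OF T subspace_span[of B]] surj by force
  have "inj_on g (span B)" using g(3) by (metis inj_onI)
  then have "g ` span B = span B" using g(1) by (intro inj_on_imp_surj_span[OF g(2) B]) auto
  then show "inj_on T (span B)" using g(3) by (smt (verit) imageE inj_onI)
qed (use inj_on_imp_surj_span[OF assms] in blast)

text \<open>The Fredholm alternative: after composing with \<open>L\<^sup>-\<^sup>1\<close> the operator differs from the identity
  by a map into a finite dimensional space \<open>E\<close>, and everything is decided on \<open>E\<close>.\<close>

lemma finite_rank_perturbation_inj_iff_surj:
  assumes L: "linear L" "bij L" and K: "finite_rank K"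
  shows "inj (\<lambda>x. L x + K x) \<longleftrightarrow> surj (\<lambda>x. L x + K x)"
proof -
  obtain g where g: "linear g" "g \<circ> L = id"
    using linear_injective_left_inverse[OF L(1)] L(2) by (auto simp: bij_def)
  have gL: "g (L x) = x" for x using g(2) by (metis comp_apply id_apply)
  have Lg: "L (g y) = y" for y using L(2) gL by (metis bij_pointE)
  obtain S where S: "finite S" "range K \<subseteq> span S" and linK: "linear K"
    using K by (auto simp: finite_rank_def)
  define T where "T x = g (L x + K x)" for x
  have T_eq: "T x = x + g (K x)" for x by (simp add: T_def linear_add[OF g(1)] gL)
  have linT: "linear T"
    unfolding T_eq[abs_def] using linear_compose[OF linK g(1)]
    by (intro linear_compose_add) (auto simp: o_def linear_id[unfolded id_def])
  let ?E = "span (g ` S)"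
  have gK: "g (K x) \<in> ?E" for x
    using S(2) linear_span_image[OF g(1), of S] by auto
  have "T ` ?E \<subseteq> ?E" using gK by (auto simp: T_eq intro: span_add)
  then have E: "inj_on T ?E \<longleftrightarrow> T ` ?E = ?E"
    using S(1) by (intro inj_on_iff_surj_span[OF linT]) auto
  have "inj T \<longleftrightarrow> inj_on T ?E"
  proof
    assume inj: "inj_on T ?E"
    have "x = 0" if "T x = 0" for x
    proof -
      have "x = - g (K x)" using that by (simp add: T_eq add_eq_0_iff2)
      then have "x \<in> ?E" using gK[of x] span_neg by metis
      then show ?thesis using inj that span_0 linear_0[OF linT] by (metis inj_onD)
    qed
    then show "inj T" using linear_injective_0[OF linT] by blast
  qed (auto intro: inj_on_subset)
  moreover have "surj T \<longleftrightarrow> T ` ?E = ?E"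
  proof
    assume surj: "surj T"
    have "y \<in> T ` ?E" if "y \<in> ?E" for y
    proof -
      obtain x where x: "y = T x" using surj by blast
      have "x = y - g (K x)" by (simp add: x T_eq)
      then have "x \<in> ?E" using that gK[of x] span_diff by metis
      then show ?thesis using x by blast
    qed
    then show "T ` ?E = ?E" using \<open>T ` ?E \<subseteq> ?E\<close> by blast
  next
    assume E: "T ` ?E = ?E"
    have "\<exists>x. T x = y" for y
    proof -
      obtain e where e: "T e = g (K y)" using gK[of y] E by (metis imageE)
      \<comment> \<open>\<open>T y\<close> exceeds \<open>y\<close> by exactly
        \<open>g (K y)\<close>, which is the value of \<open>T\<close> at \<open>e\<close>.\<close>
      have "T (y - e) = y" by (simp add: linear_diff[OF linT] e) (simp add: T_eq)
      then show ?thesis by blast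
    qed
    then show "surj T" by (metis surjI)
  qed
  moreover have "inj (\<lambda>x. L x + K x) \<longleftrightarrow> inj T"
    unfolding T_def inj_def using Lg by metis
  moreover have "surj (\<lambda>x. L x + K x) \<longleftrightarrow> surj T"
    unfolding T_def surj_def using Lg gL by metis
  ultimately show ?thesis using E by blast
qed

section \<open>Images of operators that are bounded below, and their perturbations\<close>

lemma closed_bounded_below_image:
  fixes B :: "'a::banach \<Rightarrow> 'b::real_normed_vector"
  assumes "bounded_linear B" "closed_subspace W" "c > 0" "\<And>x. x \<in> W \<Longrightarrow> c * norm x \<le> norm (B x)"
  shows "closed_subspace (B ` W)"
  using assms complete_isometric_image[of c W B]
  by (auto simp: closed_subspace_def complete_eq_closed bounded_linear.linear
      intro: complete_imp_closed linear_subspace_image)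

text \<open>A Riesz lemma argument: a vector far from the image of the perturbed operator would be the
  image under \<open>A\<close> of a short vector.\<close>

lemma surj_on_perturbation:
  fixes A B :: "'a::banach \<Rightarrow> 'b::real_normed_vector"
  assumes A: "bounded_linear A" and B: "bounded_linear B" and W: "closed_subspace W"
    and below: "\<And>x. x \<in> W \<Longrightarrow> c * norm x \<le> norm (A x)" and surj: "A ` W = UNIV"
    and near: "\<And>x. x \<in> W \<Longrightarrow> norm (B x - A x) \<le> d * norm x" and d: "0 < d" "d < c"
  shows "B ` W = UNIV"
proof (rule ccontr)
  assume "B ` W \<noteq> UNIV"
  then obtain y where y: "y \<notin> B ` W" by blast
  have "(c - d) * norm x \<le> norm (B x)" if "x \<in> W" for x
    using below[OF that] near[OF that] norm_triangle_ineq2[of "A x" "B x"]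
    by (simp add: algebra_simps norm_minus_commute)
  then have M: "closed_subspace (B ` W)"
    using d by (intro closed_bounded_below_image[OF B W, of "c - d"]) auto
  let ?D = "infdist y (B ` W)"
  have ne: "B ` W \<noteq> {}" using surj by auto
  have D: "?D > 0" using M y ne by (intro infdist_pos_not_in_closed) (auto simp: closed_subspace_def)
  \<comment> \<open>As c / d > 1, some \<open>m\<close> in the image is this close to
    \<open>y\<close>. A preimage \<open>w\<close> of \<open>y - m\<close> under \<open>A\<close>
    then has \<open>d * norm w < ?D\<close>, so \<open>m + B w\<close> is closer to \<open>y\<close>
    than the distance allows.\<close>
  then have "?D < ?D * (c / d)" using d by (simp add: field_simps)
  then obtain m where m: "m \<in> B ` W" "dist y m < ?D * (c / d)"
    using ne infdist_notempty[OF ne, of y] cINF_less_iff[of "B ` W" "dist y"]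
    by (metis bdd_below_image_dist)
  obtain w where w: "w \<in> W" "A w = y - m" using surj by (metis UNIV_I imageE)
  have "c * norm w \<le> dist y m" using below[OF w(1)] w(2) by (simp add: dist_norm)
  then have "c * norm w < ?D * (c / d)" using m(2) by simp
  then have "d * norm w < ?D" using d by (simp add: field_simps)
  moreover have "m + B w \<in> B ` W"
    using M m(1) w(1) by (auto simp: closed_subspace_def intro: subspace_add)
  then have "?D \<le> dist y (m + B w)" by (rule infdist_le)
  moreover have "dist y (m + B w) \<le> d * norm w"
    using near[OF w(1)] w(2) by (simp add: dist_norm algebra_simps norm_minus_commute)
  ultimately show False by simp
qed

text \<open>Bounded below and onto together say that \<open>A + K\<close> is an isomorphism. For
  bounded operators between Banach spaces these are the Fredholm operators of index zero.\<close>

definition index_zero :: "('a::real_normed_vector \<Rightarrow> 'b::real_normed_vector) \<Rightarrow> bool"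
  where "index_zero A \<longleftrightarrow> (\<exists>K. bounded_linear K \<and> finite_rank K \<and>
    (\<exists>c>0. \<forall>x. c * norm x \<le> norm (A x + K x)) \<and> surj (\<lambda>x. A x + K x))"

lemma bounded_below_inj:
  assumes "linear A" "c > 0" "\<And>x. c * norm x \<le> norm (A x)"
  shows "inj A"
  unfolding linear_injective_0[OF assms(1)]
  using assms(2,3) by (metis mult_le_0_iff norm_le_zero_iff norm_zero not_le)

text \<open>With \<open>K'\<close> the correction that makes \<open>A + K'\<close> bijective,
  \<open>A + K\<close> is the sum of \<open>A + K'\<close> and the finite rank map
  \<open>K - K'\<close>, so the Fredholm alternative applies.\<close>

lemma index_zero_inj_iff_surj:
  assumes A: "bounded_linear A" "index_zero A" and K: "finite_rank K"
  shows "inj (\<lambda>x. A x + K x) \<longleftrightarrow> surj (\<lambda>x. A x + K x)"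
proof -
  obtain K' c where K': "bounded_linear K'" "finite_rank K'" "c > 0"
      "\<And>x. c * norm x \<le> norm (A x + K' x)" "surj (\<lambda>x. A x + K' x)"
    using A(2) by (auto simp: index_zero_def)
  have lin: "linear (\<lambda>x. A x + K' x)"
    using A(1) K'(1) by (intro bounded_linear.linear bounded_linear_add)
  moreover have "bij (\<lambda>x. A x + K' x)"
    using bounded_below_inj[OF lin K'(3,4)] K'(5) by (simp add: bij_def)
  ultimately show ?thesis
    using finite_rank_perturbation_inj_iff_surj[OF _ _ finite_rank_diff[OF K K'(2)]] by fastforce
qed

text \<open>Functionals are removed one at a time. A direction \<open>u\<close> freed by dropping
  \<open>f\<close> is sent to a vector \<open>y\<close> missed by the current image, which keeps the
  operator bounded below on the larger kernel; the process stops early if nothing is missed.\<close>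

lemma upper_semi_fredholm_reduction:
  fixes B :: "'a::banach \<Rightarrow> 'b::real_normed_vector"
  assumes "finite F" "\<And>f. f \<in> F \<Longrightarrow> bounded_linear (f :: 'a \<Rightarrow> real)" "bounded_linear B" "c > 0"
    "\<And>x. (\<And>f. f \<in> F \<Longrightarrow> f x = 0) \<Longrightarrow> c * norm x \<le> norm (B x)"
  shows "\<exists>K W c. bounded_linear K \<and> finite_rank K \<and> closed_subspace W \<and> c > 0 \<and>
    (\<forall>x\<in>W. c * norm x \<le> norm (B x + K x)) \<and> (W = UNIV \<or> (\<lambda>x. B x + K x) ` W = UNIV)"
  using assms
proof (induction F arbitrary: B c rule: finite_induct)
  case empty
  then show ?case
    by (intro exI[of _ "\<lambda>_. 0"] exI[of _ UNIV] exI[of _ c])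
      (auto simp: bounded_linear_zero finite_rank_zero closed_subspace_def)
next
  case (insert f F)
  interpret B: bounded_linear B by fact
  interpret f: bounded_linear f using insert.prems(1) by simp
  define W where "W = {x. \<forall>g\<in>insert f F. g x = 0}"
  have W_below: "c * norm x \<le> norm (B x)" if "x \<in> W" for x
    using insert.prems(4) that by (auto simp: W_def)
  have W_eq: "W = (\<Inter>g\<in>insert f F. {x. g x = 0})" by (auto simp: W_def)
  have "subspace {x. g x = 0}" if "g \<in> insert f F" for g
    using insert.prems(1)[OF that] by (intro linear_subspace_kernel bounded_linear.linear)
  then have W: "closed_subspace W"
    unfolding closed_subspace_def W_eq using insert.prems(1) closed_zero_set
    by (intro conjI subspace_Inter closed_INT) blast+
  \<comment> \<open>Either \<open>f\<close> is redundant given \<open>F\<close>, or the image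
    already is everything, or there are both a new direction and a missed vector.\<close>
  consider (trivial) "\<And>x. (\<And>g. g \<in> F \<Longrightarrow> g x = 0) \<Longrightarrow> f x = 0" | (onto) "B ` W = UNIV"
    | (step) u0 y where "\<And>g. g \<in> F \<Longrightarrow> g u0 = 0" "f u0 \<noteq> 0" "y \<notin> B ` W"
    by blast
  then show ?case
  proof cases
    case trivial
    then show ?thesis using insert.prems by (intro insert.IH) auto
  next
    case onto
    then show ?thesis using W W_below insert.prems(3)
      by (intro exI[of _ "\<lambda>_. 0"] exI[of _ W] exI[of _ c])
        (auto simp: bounded_linear_zero finite_rank_zero)
  next
    case (step u0 y)
    define u where "u = u0 /\<^sub>R f u0"
    have u: "f u = 1" "\<And>g. g \<in> F \<Longrightarrow> g u = 0"
      using step insert.prems(1)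
      by (auto simp: u_def f.scaleR linear_cmul[OF bounded_linear.linear])
    \<comment> \<open>The rank one correction leaves \<open>B\<close> unchanged on the kernel of
      \<open>f\<close> and makes \<open>B + R\<close> send \<open>u\<close> to
      \<open>y\<close>.\<close>
    define R where "R x = f x *\<^sub>R (y - B u)" for x
    have R: "bounded_linear R" "finite_rank R"
      unfolding R_def using f.bounded_linear_axioms f.linear
      by (auto intro!: bounded_linear_scaleR_left[THEN bounded_linear_compose] finite_rank_rank_one
          simp: bounded_linear_const_scaleR)
    define M where "M = B ` W"
    have M: "closed_subspace M"
      unfolding M_def using closed_bounded_below_image[OF insert.prems(2) W insert.prems(3) W_below] .
    define d where "d = infdist y M"
    have d: "d > 0" unfolding d_def
      using M step(3) subspace_0[of M]
      by (intro infdist_pos_not_in_closed) (auto simp: closed_subspace_def M_def[symmetric])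
    have dist: "\<bar>a\<bar> * d \<le> norm (m + a *\<^sub>R y)" if "m \<in> M" for m a
    proof (cases "a = 0")
      case False
      have "- (m /\<^sub>R a) \<in> M"
        using that M by (auto simp: closed_subspace_def subspace_neg subspace_scale)
      then have "d \<le> norm (y + m /\<^sub>R a)" unfolding d_def by (metis infdist_le dist_norm diff_minus_eq_add)
      then have "\<bar>a\<bar> * d \<le> norm (a *\<^sub>R (y + m /\<^sub>R a))" by (simp add: mult_left_mono)
      also have "a *\<^sub>R (y + m /\<^sub>R a) = m + a *\<^sub>R y" using False by (simp add: algebra_simps)
      finally show ?thesis .
    qed simp
    \<comment> \<open>From \<open>x = w + f x *\<^sub>R u\<close>: with n the norm of the image,
      \<open>\<bar>f x\<bar> \<le> n / d\<close> and
      \<open>c * norm w \<le> n + n / d * norm y\<close>, which sum up to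
      \<open>norm x \<le> n * C\<close>.\<close>
    define C where "C = (1 + norm y / d) / c + norm u / d"
    have C: "C > 0" unfolding C_def using d insert.prems(3) by (simp add: add_pos_nonneg)
    have below: "1 / C * norm x \<le> norm (B x + R x)" if x: "\<And>g. g \<in> F \<Longrightarrow> g x = 0" for x
    proof -
      define w where "w = x - f x *\<^sub>R u"
      have "f w = 0" using u(1) by (simp add: w_def f.diff f.scaleR)
      moreover have "g w = 0" if "g \<in> F" for g
        using x[OF that] u(2)[OF that] insert.prems(1)[of g] that
        by (simp add: w_def linear_diff[OF bounded_linear.linear] linear_cmul[OF bounded_linear.linear])
      ultimately have w: "w \<in> W" by (simp add: W_def)
      have eq: "B x + R x = B w + f x *\<^sub>R y"
        by (simp add: w_def R_def B.diff B.scaleR algebra_simps)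
      define n where "n = norm (B x + R x)"
      have a: "\<bar>f x\<bar> \<le> n / d"
        using dist[of "B w" "f x"] w d by (simp add: M_def n_def eq field_simps)
      have "c * norm w \<le> norm (B w)" by (rule W_below[OF w])
      also have "\<dots> \<le> n + \<bar>f x\<bar> * norm y"
        using norm_triangle_ineq4[of "B w + f x *\<^sub>R y" "f x *\<^sub>R y"] by (simp add: n_def eq)
      also have "\<dots> \<le> n + n / d * norm y" using mult_right_mono[OF a, of "norm y"] by simp
      finally have nw: "norm w \<le> (n + n / d * norm y) / c"
        using insert.prems(3) by (simp add: field_simps)
      have "norm x \<le> norm w + \<bar>f x\<bar> * norm u"
        using norm_triangle_ineq[of w "f x *\<^sub>R u"] by (simp add: w_def)
      also have "\<dots> \<le> (n + n / d * norm y) / c + n / d * norm u"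
        using nw a by (intro add_mono mult_right_mono) auto
      also have "\<dots> = n * C" by (simp add: C_def algebra_simps add_divide_distrib)
      finally show ?thesis using C by (simp add: n_def field_simps)
    qed
    have "bounded_linear (\<lambda>x. B x + R x)"
      using insert.prems(2) R(1) by (rule bounded_linear_add)
    then have "\<exists>K V c'. bounded_linear K \<and> finite_rank K \<and> closed_subspace V \<and> c' > 0 \<and>
      (\<forall>x\<in>V. c' * norm x \<le> norm (B x + R x + K x)) \<and> (V = UNIV \<or> (\<lambda>x. B x + R x + K x) ` V = UNIV)"
      using C insert.prems(1) below by (intro insert.IH[of "\<lambda>x. B x + R x" "1 / C"]) auto
    then obtain K V c' where K: "bounded_linear K" "finite_rank K" "closed_subspace V" "c' > 0"
      "\<forall>x\<in>V. c' * norm x \<le> norm (B x + R x + K x)"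
      "V = UNIV \<or> (\<lambda>x. B x + R x + K x) ` V = UNIV"
      by (elim exE conjE) (rule that)
    then show ?thesis
      using R by (intro exI[of _ "\<lambda>x. R x + K x"] exI[of _ V] exI[of _ c'])
        (auto simp: add.assoc intro: bounded_linear_add finite_rank_add)
  qed
qed

text \<open>Near \<open>A\<close> the property is decided by a fixed finite rank correction \<open>K\<close>.  If \<open>W\<close> is the
  whole space then \<open>A + K\<close> is bounded below and only surjectivity is at stake.  Otherwise
  \<open>A + K\<close> has positive index: it and its small perturbations map the proper subspace \<open>W\<close> onto
  the whole space, so they are onto but not injective.\<close>

lemma index_zero_locally_constant:
  fixes A :: "'a::banach \<Rightarrow> 'b::real_normed_vector"
  assumes A: "bounded_linear A" and usf: "upper_semi_fredholm A"
  obtains e where "e > 0" "\<And>B. bounded_linear B \<Longrightarrow> (\<And>x. norm (B x - A x) \<le> e * norm x) \<Longrightarrow>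
    index_zero B \<longleftrightarrow> index_zero A"
proof -
  obtain F c0 where F: "finite F" "\<forall>f\<in>F. bounded_linear (f :: 'a \<Rightarrow> real)" "c0 > 0"
    "\<forall>x. (\<forall>f\<in>F. f x = 0) \<longrightarrow> c0 * norm x \<le> norm (A x)"
    using usf unfolding upper_semi_fredholm_def by (elim exE conjE) (rule that)
  have "\<exists>K W c. bounded_linear K \<and> finite_rank K \<and> closed_subspace W \<and> c > 0 \<and>
    (\<forall>x\<in>W. c * norm x \<le> norm (A x + K x)) \<and> (W = UNIV \<or> (\<lambda>x. A x + K x) ` W = UNIV)"
    using F by (intro upper_semi_fredholm_reduction[OF F(1) _ A F(3)]) auto
  then obtain K W c where K: "bounded_linear K" "finite_rank K" and W: "closed_subspace W" and c: "c > 0"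
    and below: "\<And>x. x \<in> W \<Longrightarrow> c * norm x \<le> norm (A x + K x)"
    and alt: "W = UNIV \<or> (\<lambda>x. A x + K x) ` W = UNIV"
    by (elim exE conjE) (rule that, auto)
  have AK: "bounded_linear (\<lambda>x. A x + K x)" using A K(1) by (rule bounded_linear_add)
  show ?thesis
  \<comment> \<open>\<open>B + K\<close> stays bounded below by 2c/3 on \<open>W\<close>. As c/3 is
    less than both c and 2c/3, surjectivity passes between \<open>A + K\<close> and
    \<open>B + K\<close> in either direction.\<close>
  proof (rule that[of "c / 3"])
    fix B assume B: "bounded_linear B" and near: "\<And>x. norm (B x - A x) \<le> c / 3 * norm x"
    have BK: "bounded_linear (\<lambda>x. B x + K x)" using B K(1) by (rule bounded_linear_add)
    have below': "2 * c / 3 * norm x \<le> norm (B x + K x)" if "x \<in> W" for x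
      using below[OF that] near[of x] norm_triangle_ineq2[of "A x + K x" "B x + K x"]
      by (simp add: norm_minus_commute)
    show "index_zero B \<longleftrightarrow> index_zero A"
    proof (cases "W = UNIV")
      case True
      have iff: "index_zero T \<longleftrightarrow> surj (\<lambda>x. T x + K x)"
        if T: "bounded_linear T" "d > 0" "\<And>x. d * norm x \<le> norm (T x + K x)" for T d
      proof
        have "linear (\<lambda>x. T x + K x)" using T(1) K(1) by (intro bounded_linear.linear bounded_linear_add)
        then have "inj (\<lambda>x. T x + K x)" using T(2,3) by (rule bounded_below_inj)
        then show "surj (\<lambda>x. T x + K x)" if "index_zero T"
          using index_zero_inj_iff_surj[OF T(1) that K(2)] by blast
        show "index_zero T" if "surj (\<lambda>x. T x + K x)"
          using that T K unfolding index_zero_def by blast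
      qed
      have "surj (\<lambda>x. B x + K x)" if "surj (\<lambda>x. A x + K x)"
        using surj_on_perturbation[OF AK BK W below that[folded True] _, of "c / 3"] near c True by simp
      moreover have "surj (\<lambda>x. A x + K x)" if "surj (\<lambda>x. B x + K x)"
        using surj_on_perturbation[OF BK AK W below' that[folded True] _, of "c / 3"] near c True
        by (simp add: norm_minus_commute)
      moreover have "index_zero A \<longleftrightarrow> surj (\<lambda>x. A x + K x)"
        using below True c by (intro iff[OF A, of c]) auto
      moreover have "index_zero B \<longleftrightarrow> surj (\<lambda>x. B x + K x)"
        using below' True c by (intro iff[OF B, of "2 * c / 3"]) auto
      ultimately show ?thesis by blast
    next
      case False
      then have onto: "(\<lambda>x. A x + K x) ` W = UNIV" using alt by blast
      then have onto': "(\<lambda>x. B x + K x) ` W = UNIV"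
        using surj_on_perturbation[OF AK BK W below onto, of "c / 3"] near c by simp
      have not_zero: "\<not> index_zero T"
        if T: "bounded_linear T" and onto: "(\<lambda>x. T x + K x) ` W = UNIV" for T
      proof
        assume "index_zero T"
        moreover have "surj (\<lambda>x. T x + K x)" using onto by blast
        ultimately have inj: "inj (\<lambda>x. T x + K x)" using index_zero_inj_iff_surj[OF T _ K(2)] by blast
        obtain x where x: "x \<notin> W" using False by blast
        obtain w where "w \<in> W" "T x + K x = T w + K w" using onto by (metis (mono_tags, lifting) UNIV_I imageE)
        then show False using injD[OF inj, of x w] x by auto
      qed
      show ?thesis using not_zero[OF A onto] not_zero[OF B onto'] by blast
    qed
  qed (use c in simp)
qed

section \<open>Parity of the index\<close>

text \<open>Coordinates of \<open>K x\<close> in a basis of a finite dimensional space containing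
  the range; they supply the finite set on which the parity induction runs.\<close>

lemma finite_rank_separating_functionals:
  fixes K :: "'a::real_vector \<Rightarrow> 'b::real_vector"
  assumes "finite_rank K"
  obtains G where "finite G" "\<And>g. g \<in> G \<Longrightarrow> linear (g :: 'a \<Rightarrow> real)"
    "\<And>x. (\<And>g. g \<in> G \<Longrightarrow> g x = 0) \<Longrightarrow> K x = 0"
proof -
  obtain S0 where S0: "finite S0" "range K \<subseteq> span S0" and K: "linear K"
    using assms by (auto simp: finite_rank_def)
  obtain S where S: "S \<subseteq> S0" "independent S" "S0 \<subseteq> span S"
    using maximal_independent_subset[of S0] by blast
  have fin: "finite S" using S(1) S0(1) finite_subset by blast
  have KS: "K x \<in> span S" for x
    using S0(2) S(3) span_minimal[OF S(3) subspace_span] by blast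
  let ?g = "\<lambda>b x. representation S (K x) b"
  show ?thesis
  proof (rule that[of "?g ` S"])
    show "linear g" if "g \<in> ?g ` S" for g
      using that KS S(2)
      by (auto intro!: linearI simp: linear_add[OF K] linear_cmul[OF K] representation_add representation_scale)
    show "K x = 0" if "\<And>g. g \<in> ?g ` S \<Longrightarrow> g x = 0" for x
    proof -
      have "?g b x = 0" if "b \<in> S" for b using \<open>\<And>g. g \<in> ?g ` S \<Longrightarrow> g x = 0\<close>[of "?g b"] that by blast
      then show ?thesis using sum_representation_eq[OF S(2) KS fin order_refl, of x] by simp
    qed
  qed (use fin in simp)
qed

text \<open>\<open>Q\<close> is a complex structure on the hyperplane where \<open>\<phi>\<close> vanishes, extended by \<open>0\<close> at \<open>v\<close>.\<close>

locale complex_hyperplane =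
  fixes I Q :: "'a::real_vector \<Rightarrow> 'a" and \<phi> :: "'a \<Rightarrow> real" and v :: 'a
  assumes linear_I: "linear I" and linear_Q: "linear Q" and linear_\<phi>: "linear \<phi>"
    and II: "I (I x) = - x" and QQ: "Q (Q x) = \<phi> x *\<^sub>R v - x" and \<phi>_Q: "\<phi> (Q x) = 0" and \<phi>_v: "\<phi> v = 1"
begin

lemma QQQ: "Q (Q (Q x)) = - Q x"
  by (simp add: QQ[of "Q x"] \<phi>_Q)

lemma Q_v: "Q v = 0"
  using QQQ[of v] QQ[of v] by (simp add: \<phi>_v linear_0[OF linear_Q])

text \<open>The range of \<open>A\<close> is stable under \<open>I\<close>. A relation puts
  (\<alpha> + \<beta> I) y into it; multiplying by the conjugate \<alpha> - \<beta> I puts a nonzero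
  real multiple of \<open>y\<close> there.\<close>

lemma complex_independent_modulo_range:
  assumes A: "linear A" "\<And>x. A (Q x) = I (A x)" and y: "y \<notin> range A" and eq: "A z + \<alpha> *\<^sub>R y + \<beta> *\<^sub>R I y = 0"
  shows "\<alpha> = 0 \<and> \<beta> = 0"
proof (rule ccontr)
  assume "\<not> (\<alpha> = 0 \<and> \<beta> = 0)"
  then have ne: "\<alpha> * \<alpha> + \<beta> * \<beta> \<noteq> 0" by (simp add: sum_squares_eq_zero_iff)
  have "I (A z + \<alpha> *\<^sub>R y + \<beta> *\<^sub>R I y) = 0" using eq by (simp add: linear_0[OF linear_I])
  then have "I (A z) + \<alpha> *\<^sub>R I y - \<beta> *\<^sub>R y = 0"
    by (simp add: linear_add[OF linear_I] linear_cmul[OF linear_I] II)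
  then have "\<alpha> *\<^sub>R (A z + \<alpha> *\<^sub>R y + \<beta> *\<^sub>R I y) - \<beta> *\<^sub>R (I (A z) + \<alpha> *\<^sub>R I y - \<beta> *\<^sub>R y) = 0"
    by (simp only: eq) simp
  then have "(\<alpha> * \<alpha> + \<beta> * \<beta>) *\<^sub>R y = \<beta> *\<^sub>R I (A z) - \<alpha> *\<^sub>R A z"
    by (simp add: algebra_simps)
  also have "\<dots> = A (\<beta> *\<^sub>R Q z - \<alpha> *\<^sub>R z)"
    by (simp add: linear_diff[OF A(1)] linear_cmul[OF A(1)] A(2))
  finally have eq': "(\<alpha> * \<alpha> + \<beta> * \<beta>) *\<^sub>R y = A (\<beta> *\<^sub>R Q z - \<alpha> *\<^sub>R z)" .
  have "y = ((\<alpha> * \<alpha> + \<beta> * \<beta>) *\<^sub>R y) /\<^sub>R (\<alpha> * \<alpha> + \<beta> * \<beta>)" using ne by simp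
  also have "\<dots> = A ((\<beta> *\<^sub>R Q z - \<alpha> *\<^sub>R z) /\<^sub>R (\<alpha> * \<alpha> + \<beta> * \<beta>))"
    unfolding eq' by (rule linear_cmul[OF A(1), symmetric])
  finally have "y = A ((\<beta> *\<^sub>R Q z - \<alpha> *\<^sub>R z) /\<^sub>R (\<alpha> * \<alpha> + \<beta> * \<beta>))" .
  then show False using y by blast
qed

text \<open>A complex linear map from a complex hyperplane has even index, whereas index zero for \<open>A\<close>
  on the whole space means index \<open>- 1\<close> for its restriction.  The induction kills the kernel of
  the restriction by complex linear corrections of finite rank; once it is injective, its range
  would be a real hyperplane stable under \<open>I\<close>.\<close>

lemma complex_index_contradiction:
  assumes "finite G" "\<And>g. g \<in> G \<Longrightarrow> linear (g :: 'a \<Rightarrow> real)" "linear A" "A v = 0" "\<And>x. A (Q x) = I (A x)"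
    "\<And>x. A x = 0 \<Longrightarrow> \<phi> x = 0 \<Longrightarrow> (\<And>g. g \<in> G \<Longrightarrow> g x = 0) \<Longrightarrow> x = 0"
    "\<And>K. finite_rank K \<Longrightarrow> inj (\<lambda>x. A x + K x) \<longleftrightarrow> surj (\<lambda>x. A x + K x)"
  shows False
  using assms
proof (induction G arbitrary: A rule: finite_induct)
  case empty
  note A = empty.prems
  \<comment> \<open>\<open>A\<close> kills \<open>v \<noteq> 0\<close>, so it is not injective, and
    the alternative with \<open>K = 0\<close> applies.\<close>
  have "\<not> surj A"
    using A(6)[OF finite_rank_zero] A(3) \<phi>_v linear_0[OF A(2)] linear_0[OF linear_\<phi>]
    by (auto dest: injD[of A v 0])
  then obtain y where y: "y \<notin> range A" by blast
  \<comment> \<open>Adding one real dimension to the range makes \<open>A\<close> injective, hence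
    onto; but then \<open>I y\<close> would lie in the span of the range and
    \<open>y\<close>.\<close>
  have ker: "\<phi> x = 0 \<and> A x = 0" if "A x + \<phi> x *\<^sub>R y = 0" for x
    using complex_independent_modulo_range[OF A(2,4) y, of x "\<phi> x" 0] that by simp
  have lin: "linear (\<lambda>x. A x + \<phi> x *\<^sub>R y)"
    using finite_rank_rank_one[OF linear_\<phi>] A(2) by (intro linear_compose_add) (auto simp: finite_rank_def)
  have "inj (\<lambda>x. A x + \<phi> x *\<^sub>R y)"
    unfolding linear_injective_0[OF lin] using ker A(5) by blast
  then have "surj (\<lambda>x. A x + \<phi> x *\<^sub>R y)"
    using A(6)[OF finite_rank_rank_one[OF linear_\<phi>]] by blast
  from surjD[OF this, of "I y"] obtain z where "I y = A z + \<phi> z *\<^sub>R y" by blast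
  then have "A z + \<phi> z *\<^sub>R y + (- 1) *\<^sub>R I y = 0" by simp
  then show False using complex_independent_modulo_range[OF A(2,4) y] by fastforce
next
  case (insert g G)
  note A = insert.prems
  have g: "linear g" using A(1) by simp
  have "\<not> surj A"
    using A(6)[OF finite_rank_zero] A(3) \<phi>_v linear_0[OF A(2)] linear_0[OF linear_\<phi>]
    by (auto dest: injD[of A v 0])
  then obtain y where y: "y \<notin> range A" by blast
  \<comment> \<open>On the hyperplane \<open>Q (Q x) = - x\<close>, so this is \<open>y\<close>
    times the complex functional with real part \<open>g\<close>. Writing \<open>Q (Q x)\<close> in
    place of \<open>- x\<close> makes \<open>R\<close> vanish at \<open>v\<close> and satisfy
    \<open>R (Q x) = I (R x)\<close> everywhere.\<close>
  define R where "R x = - g (Q (Q x)) *\<^sub>R y + - g (Q x) *\<^sub>R I y" for x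
  have "linear (\<lambda>x. - g (Q (Q x)))" "linear (\<lambda>x. - g (Q x))"
    using linear_compose[OF linear_Q g] linear_compose[OF linear_compose[OF linear_Q linear_Q] g]
    by (auto simp: o_def intro: linear_compose_neg)
  then have R: "finite_rank R"
    unfolding R_def by (intro finite_rank_add finite_rank_rank_one)
  show False
  proof (rule insert.IH[of "\<lambda>x. A x + R x"])
    show "linear (\<lambda>x. A x + R x)"
      using A(2) R by (intro linear_compose_add) (auto simp: finite_rank_def)
    show "A v + R v = 0"
      by (simp add: A(3) R_def Q_v linear_0[OF linear_Q] linear_0[OF g])
    show "A (Q x) + R (Q x) = I (A x + R x)" for x
      by (simp add: A(4) R_def QQQ linear_neg[OF g] linear_add[OF linear_I] linear_diff[OF linear_I]
          linear_neg[OF linear_I] linear_cmul[OF linear_I] II)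
    \<comment> \<open>Independence of \<open>y\<close> and \<open>I y\<close> modulo the range
      forces \<open>A x = 0\<close> and \<open>g x = 0\<close>, so \<open>g\<close> may be dropped
      from the set.\<close>
    show "x = 0" if x: "A x + R x = 0" "\<phi> x = 0" "\<And>h. h \<in> G \<Longrightarrow> h x = 0" for x
    proof -
      have "A x + (- g (Q (Q x))) *\<^sub>R y + (- g (Q x)) *\<^sub>R I y = 0"
        using x(1) by (simp add: R_def algebra_simps)
      from complex_independent_modulo_range[OF A(2,4) y this]
      have "g (Q (Q x)) = 0" "g (Q x) = 0" by auto
      then have "g x = 0" "A x = 0" using x(1,2) by (auto simp: QQ R_def linear_neg[OF g])
      then show ?thesis using A(5)[of x] x by auto
    qed
    show "inj (\<lambda>x. A x + R x + K x) \<longleftrightarrow> surj (\<lambda>x. A x + R x + K x)" if "finite_rank K" for K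
      using A(6)[OF finite_rank_add[OF R that]] by (simp add: add.assoc)
  qed (use A(1) in auto)
qed

end

section \<open>Complex structures on a space and on a hyperplane\<close>

text \<open>\<open>\<phi>\<close> is the coordinate along \<open>v\<close>; it is bounded by the
  inverse of the distance from \<open>v\<close> to \<open>H\<close>, which is positive because
  \<open>H\<close> is closed.\<close>

lemma hyperplane_functional:
  fixes H :: "'a::real_normed_vector set"
  assumes "hyperplane H"
  obtains \<phi> :: "'a \<Rightarrow> real" and v where "bounded_linear \<phi>" "\<phi> v = 1" "H = {x. \<phi> x = 0}"
proof -
  obtain v where H: "subspace H" "closed H" and v: "v \<notin> H" "span (insert v H) = UNIV"
    using assms by (auto simp: hyperplane_def closed_subspace_def)
  have "\<exists>k. x - k *\<^sub>R v \<in> H" for x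
    using span_breakdown_eq[of x v H] v(2) H(1) span_eq_iff[THEN iffD2, OF H(1)] by auto
  then obtain \<phi> where \<phi>: "x - \<phi> x *\<^sub>R v \<in> H" for x by metis
  have unique: "k = l" if "x - k *\<^sub>R v \<in> H" "x - l *\<^sub>R v \<in> H" for x k l
  proof (rule ccontr)
    assume "k \<noteq> l"
    have "(x - k *\<^sub>R v) - (x - l *\<^sub>R v) \<in> H" by (intro subspace_diff H(1) that)
    then have "(l - k) *\<^sub>R v \<in> H" by (simp add: algebra_simps)
    then have "((l - k) *\<^sub>R v) /\<^sub>R (l - k) \<in> H" by (rule subspace_scale[OF H(1)])
    then show False using v(1) \<open>k \<noteq> l\<close> by simp
  qed
  have ne: "H \<noteq> {}" using subspace_0[OF H(1)] by blast
  have d: "infdist v H > 0" by (rule infdist_pos_not_in_closed[OF H(2) ne v(1)])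
  have "bounded_linear \<phi>"
  proof (rule bounded_linear_intro[of _ "1 / infdist v H"])
    show "\<phi> (x + y) = \<phi> x + \<phi> y" for x y
    proof (rule unique[of "x + y"])
      have "(x - \<phi> x *\<^sub>R v) + (y - \<phi> y *\<^sub>R v) \<in> H" by (intro subspace_add H(1) \<phi>)
      then show "x + y - (\<phi> x + \<phi> y) *\<^sub>R v \<in> H" by (simp add: algebra_simps)
    qed (rule \<phi>)
    show "\<phi> (r *\<^sub>R x) = r *\<^sub>R \<phi> x" for r x
    proof (rule unique[of "r *\<^sub>R x"])
      have "r *\<^sub>R (x - \<phi> x *\<^sub>R v) \<in> H" by (intro subspace_scale H(1) \<phi>)
      then show "r *\<^sub>R x - (r *\<^sub>R \<phi> x) *\<^sub>R v \<in> H" by (simp add: algebra_simps)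
    qed (rule \<phi>)
    show "norm (\<phi> x) \<le> norm x * (1 / infdist v H)" for x
    proof (cases "\<phi> x = 0")
      case False
      have "- ((x - \<phi> x *\<^sub>R v) /\<^sub>R \<phi> x) \<in> H" by (intro subspace_neg subspace_scale H(1) \<phi>)
      then have "infdist v H \<le> dist v (- ((x - \<phi> x *\<^sub>R v) /\<^sub>R \<phi> x))" by (rule infdist_le)
      also have "\<dots> = norm (x /\<^sub>R \<phi> x)" using False by (simp add: dist_norm algebra_simps)
      finally show ?thesis using False d by (simp add: field_simps)
    qed (use d in simp)
  qed
  moreover have "\<phi> v = 1"
    using unique[of v "\<phi> v" 1] \<phi>[of v] subspace_0[OF H(1)] by simp
  moreover have "H = {x. \<phi> x = 0}"
  proof (intro set_eqI iffI)
    show "x \<in> {x. \<phi> x = 0}" if "x \<in> H" for x using unique[of x "\<phi> x" 0] \<phi>[of x] that by simp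
    show "x \<in> H" if "x \<in> {x. \<phi> x = 0}" for x using \<phi>[of x] that by simp
  qed
  ultimately show ?thesis by (rule that)
qed

section \<open>Operators on subspaces and the seminorm\<close>

lemma bounded_linear_on_subset: "bounded_linear_on S f \<Longrightarrow> T \<subseteq> S \<Longrightarrow> bounded_linear_on T f"
  unfolding bounded_linear_on_def by (metis subsetD)

lemma bounded_linear_on_diff:
  assumes "bounded_linear_on S f" "bounded_linear_on S g"
  shows "bounded_linear_on S (\<lambda>x. f x - g x)"
proof -
  obtain K L where K: "\<forall>x\<in>S. norm (f x) \<le> norm x * K" and L: "\<forall>x\<in>S. norm (g x) \<le> norm x * L"
    using assms by (auto simp: bounded_linear_on_def)
  have "norm (f x - g x) \<le> norm x * (K + L)" if "x \<in> S" for x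
    using bspec[OF K that] bspec[OF L that] norm_triangle_ineq4[of "f x" "g x"]
    by (simp add: algebra_simps)
  then have "\<exists>C. \<forall>x\<in>S. norm (f x - g x) \<le> norm x * C" by blast
  then show ?thesis
    using assms unfolding bounded_linear_on_def by (simp add: algebra_simps)
qed

lemma bounded_linear_on_compose:
  assumes "bounded_linear_on H J" "bounded_linear P" "range P \<subseteq> H"
  shows "bounded_linear (\<lambda>x. J (P x))"
proof -
  interpret P: bounded_linear P by fact
  have PH: "P x \<in> H" for x using assms(3) by blast
  obtain K where K: "\<forall>x\<in>H. norm (J x) \<le> norm x * K" using assms(1) by (auto simp: bounded_linear_on_def)
  obtain L where L: "\<And>x. norm (P x) \<le> norm x * L" using P.bounded by blast
  show ?thesis
  proof (rule bounded_linear_intro[of _ "L * \<bar>K\<bar>"])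
    show "J (P (x + y)) = J (P x) + J (P y)" "J (P (r *\<^sub>R x)) = r *\<^sub>R J (P x)" for x y r
      using assms(1) PH by (auto simp: bounded_linear_on_def P.add P.scaleR)
    show "norm (J (P x)) \<le> norm x * (L * \<bar>K\<bar>)" for x
    proof -
      have "norm (J (P x)) \<le> norm (P x) * K" using K PH by blast
      also have "\<dots> \<le> norm (P x) * \<bar>K\<bar>" by (intro mult_left_mono) auto
      also have "\<dots> \<le> (norm x * L) * \<bar>K\<bar>" using L by (intro mult_right_mono) auto
      finally show ?thesis by (simp add: mult.assoc)
    qed
  qed
qed

text \<open>Boundedness of \<open>f\<close> on \<open>Z\<close> makes the quotients bounded above,
  so the supremum really dominates them.\<close>

lemma onorm_on_bound:
  assumes "bounded_linear_on Z f" "onorm_on Z f \<le> \<epsilon>" "x \<in> Z"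
  shows "norm (f x) \<le> \<epsilon> * norm x"
proof (cases "x = 0")
  case True
  then show ?thesis using assms(1,3) by (auto simp: bounded_linear_on_def)
next
  case False
  obtain K where K: "\<forall>x\<in>Z. norm (f x) \<le> norm x * K" using assms(1) by (auto simp: bounded_linear_on_def)
  have "norm (f x) / norm x \<le> \<bar>K\<bar>" if "x \<in> Z" for x
  proof (cases "x = 0")
    case False
    then have "norm (f x) / norm x \<le> K" using bspec[OF K that] by (simp add: field_simps)
    then show ?thesis by simp
  qed simp
  then have "bdd_above ((\<lambda>x. norm (f x) / norm x) ` Z)" by (intro bdd_aboveI2)
  then have "norm (f x) / norm x \<le> onorm_on Z f"
    unfolding onorm_on_def using assms(3) by (rule cSUP_upper2) simp
  then have "norm (f x) / norm x \<le> \<epsilon>" using assms(2) by simp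
  then show ?thesis using False by (simp add: field_simps)
qed

lemma S_admissible_small_subspace:
  assumes "S_admissible H f \<epsilon>" "bounded_linear_on H f" "closed_subspace Z" "infinite_dimensional Z" "Z \<subseteq> H"
  obtains Z' where "closed_subspace Z'" "infinite_dimensional Z'" "Z' \<subseteq> Z"
    "\<And>x. x \<in> Z' \<Longrightarrow> norm (f x) \<le> \<epsilon> * norm x"
proof -
  obtain Z' where Z': "closed_subspace Z'" "infinite_dimensional Z'" "Z' \<subseteq> Z" "onorm_on Z' f \<le> \<epsilon>"
    using assms(1,3-5) unfolding S_admissible_def by blast
  have "bounded_linear_on Z' f" using bounded_linear_on_subset[OF assms(2)] Z'(3) assms(5) by blast
  then show ?thesis using that[OF Z'(1-3)] onorm_on_bound Z'(4) by blast
qed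

lemma infinite_dimensional_nonzero:
  assumes "infinite_dimensional S" "subspace S"
  obtains x where "x \<in> S" "x \<noteq> 0"
proof -
  have "S \<noteq> {0}" using assms(1) by (auto simp: infinite_dimensional_def intro: exI[of _ "{}"])
  then show ?thesis using subspace_0[OF assms(2)] that by blast
qed

text \<open>Since the inverse of \<open>I\<close> is \<open>- I\<close>, the image of
  \<open>Z\<close> is also its preimage, hence closed; and \<open>I\<close> carries a finite
  spanning set of the image back to one of \<open>Z\<close>.\<close>

lemma complex_structure_image:
  assumes I: "bounded_linear I" "\<And>x. I (I x) = - x"
    and Z: "closed_subspace Z" "infinite_dimensional Z"
  shows "closed_subspace (I ` Z)" "infinite_dimensional (I ` Z)"
proof -
  interpret I: bounded_linear I by fact
  have sub: "subspace Z" and cl: "closed Z" using Z(1) by (auto simp: closed_subspace_def)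
  have II: "I ` I ` S = S" if "subspace S" for S
    using that subspace_neg[OF that] by (force simp: I(2) image_iff)
  have "I ` Z = I -` Z"
  proof (intro subset_antisym subsetI)
    show "x \<in> I -` Z" if "x \<in> I ` Z" for x using that sub by (auto simp: I(2) subspace_neg)
    show "x \<in> I ` Z" if "x \<in> I -` Z" for x
      using that sub by (intro image_eqI[of _ _ "- I x"]) (auto simp: I(2) I.neg subspace_neg)
  qed
  then show "closed_subspace (I ` Z)"
    using sub cl by (simp add: closed_subspace_def linear_subspace_vimage[OF I.linear]
        continuous_closed_vimage[OF cl] I.isCont[OF continuous_ident])
  show "infinite_dimensional (I ` Z)"
    unfolding infinite_dimensional_def
  proof
    assume "\<exists>B. finite B \<and> B \<subseteq> I ` Z \<and> I ` Z = span B"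
    then obtain B where B: "finite B" "I ` Z = span B" by blast
    then have "Z = span (I ` B)" using II[OF sub] linear_span_image[OF I.linear, of B] by simp
    moreover have "finite (I ` B)" using B(1) by simp
    ultimately have "\<exists>C. finite C \<and> C \<subseteq> Z \<and> Z = span C" using span_superset[of "I ` B"] by metis
    then show False using Z(2) by (simp add: infinite_dimensional_def)
  qed
qed

section \<open>The path from 2 I to I + J\<close>

locale complex_structure_pair =
  fixes I J :: "'a::banach \<Rightarrow> 'a" and \<phi> :: "'a \<Rightarrow> real" and v :: 'a
  assumes I: "complex_structure UNIV I" and J: "complex_structure {x. \<phi> x = 0} J"
    and \<phi>: "bounded_linear \<phi>" and \<phi>_v: "\<phi> v = 1"
begin

sublocale I: bounded_linear I
  using I by (simp add: complex_structure_def bounded_linear_on_UNIV)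

sublocale \<phi>: bounded_linear \<phi> by (rule \<phi>)

lemma II: "I (I x) = - x"
  using I by (simp add: complex_structure_def)

lemma JJ: "\<phi> x = 0 \<Longrightarrow> J (J x) = - x" and \<phi>_J: "\<phi> x = 0 \<Longrightarrow> \<phi> (J x) = 0"
  using J by (auto simp: complex_structure_def)

lemma J_add: "\<phi> x = 0 \<Longrightarrow> \<phi> y = 0 \<Longrightarrow> J (x + y) = J x + J y"
  and J_scale: "\<phi> x = 0 \<Longrightarrow> J (r *\<^sub>R x) = r *\<^sub>R J x"
  using J by (auto simp: complex_structure_def bounded_linear_on_def)

definition P where "P x = x - \<phi> x *\<^sub>R v"

definition Q where "Q x = J (P x)"

text \<open>On the hyperplane \<open>2 *\<^sub>R I x = path s x + s *\<^sub>R (I x - J x)\<close>;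
  the projection \<open>P\<close> extends the operators by \<open>0\<close> along
  \<open>v\<close>.\<close>

definition path where "path s x = (2 - s) *\<^sub>R I (P x) + s *\<^sub>R Q x"

lemma \<phi>_P: "\<phi> (P x) = 0"
  by (simp add: P_def \<phi>.diff \<phi>.scaleR \<phi>_v)

lemma P_id: "\<phi> x = 0 \<Longrightarrow> P x = x"
  by (simp add: P_def)

lemma bounded_linear_P: "bounded_linear P"
  unfolding P_def[abs_def]
  by (intro bounded_linear_sub bounded_linear_ident bounded_linear_compose[OF bounded_linear_scaleR_left \<phi>])

lemma bounded_linear_IP: "bounded_linear (\<lambda>x. I (P x))"
  by (rule bounded_linear_compose[OF I.bounded_linear_axioms bounded_linear_P])

lemma bounded_linear_Q: "bounded_linear Q"
  unfolding Q_def[abs_def] using J \<phi>_P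
  by (intro bounded_linear_on_compose[OF _ bounded_linear_P]) (auto simp: complex_structure_def)

lemma bounded_linear_path: "bounded_linear (path s)"
  unfolding path_def[abs_def]
  by (intro bounded_linear_add bounded_linear_const_scaleR bounded_linear_IP bounded_linear_Q)

lemma bounded_linear_on_difference: "bounded_linear_on {x. \<phi> x = 0} (\<lambda>x. I x - J x)"
proof (rule bounded_linear_on_diff)
  show "bounded_linear_on {x. \<phi> x = 0} I"
    using I bounded_linear_on_subset[of UNIV I] by (simp add: complex_structure_def)
qed (use J in \<open>simp add: complex_structure_def\<close>)

lemma upper_semi_fredholm_path:
  assumes adm: "S_admissible {x. \<phi> x = 0} (\<lambda>x. I x - J x) \<epsilon>" and \<epsilon>: "0 < \<epsilon>" "\<epsilon> < 2" and s: "0 \<le> s" "s \<le> 1"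
  shows "upper_semi_fredholm (path s)"
proof (rule ccontr)
  assume sing: "\<not> upper_semi_fredholm (path s)"
  let ?T = "\<lambda>x. I x - J x"
  obtain M0 where M0: "\<And>x. \<phi> x = 0 \<Longrightarrow> norm (J x) \<le> norm x * M0"
    using J by (auto simp: complex_structure_def bounded_linear_on_def)
  define M where "M = \<bar>M0\<bar>"
  have M: "norm (J x) \<le> M * norm x" if "\<phi> x = 0" for x
    using M0[OF that] mult_right_mono[OF abs_ge_self[of M0] norm_ge_zero[of x]]
    by (simp add: M_def mult.commute)
  have M_pos: "M \<ge> 0" by (simp add: M_def)
  \<comment> \<open>Chosen so that the total error \<open>2 * (\<epsilon> + M) * \<delta>\<close> is
    half of the gap \<open>4 - \<epsilon>\<^sup>2\<close>.\<close>
  define \<delta> where "\<delta> = (4 - \<epsilon>\<^sup>2) / 4 / (\<epsilon> + M)"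
  have \<epsilon>2: "\<epsilon>\<^sup>2 < 4" using \<epsilon> power_strict_mono[of \<epsilon> 2 2] by simp
  have \<delta>: "\<delta> > 0" unfolding \<delta>_def using \<epsilon> \<epsilon>2 M_pos by simp
  \<comment> \<open>Annihilating \<open>\<phi>\<close> composed with \<open>I\<close> as well keeps
    \<open>I z\<close> in the hyperplane, where \<open>J\<close> acts.\<close>
  obtain Z where Z: "closed_subspace Z" "infinite_dimensional Z"
    and Z_zero: "\<And>z f. z \<in> Z \<Longrightarrow> f \<in> {\<phi>, \<lambda>x. \<phi> (I x)} \<Longrightarrow> f z = 0"
    and Z_small: "\<And>z. z \<in> Z \<Longrightarrow> norm (path s z) \<le> \<delta> * norm z"
    using not_upper_semi_fredholm_small_subspace[OF bounded_linear_path sing _ _ \<delta>,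
        of "{\<phi>, \<lambda>x. \<phi> (I x)}"] \<phi> bounded_linear_compose[OF \<phi> I.bounded_linear_axioms] by blast
  have \<phi>_Z: "\<phi> z = 0" "\<phi> (I z) = 0" if "z \<in> Z" for z using Z_zero[OF that] by auto
  obtain Z1 where Z1: "closed_subspace Z1" "infinite_dimensional Z1" "Z1 \<subseteq> Z"
    and Z1_small: "\<And>x. x \<in> Z1 \<Longrightarrow> norm (?T x) \<le> \<epsilon> * norm x"
    using S_admissible_small_subspace[OF adm bounded_linear_on_difference Z] \<phi>_Z by blast
  have "I ` Z1 \<subseteq> {x. \<phi> x = 0}" using Z1(3) \<phi>_Z by auto
  \<comment> \<open>Passing to a subspace of the image of \<open>Z1\<close> yields one vector
    \<open>z\<close> such that the estimate for \<open>I - J\<close> holds at both \<open>z\<close>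
    and \<open>I z\<close>.\<close>
  then obtain Z2 where Z2: "closed_subspace Z2" "infinite_dimensional Z2" "Z2 \<subseteq> I ` Z1"
    and Z2_small: "\<And>x. x \<in> Z2 \<Longrightarrow> norm (?T x) \<le> \<epsilon> * norm x"
    using S_admissible_small_subspace[OF adm bounded_linear_on_difference
        complex_structure_image[OF I.bounded_linear_axioms II Z1(1,2)]] by blast
  obtain w where w: "w \<in> Z2" "w \<noteq> 0"
    using infinite_dimensional_nonzero[OF Z2(2)] Z2(1) unfolding closed_subspace_def by blast
  then obtain z where z: "z \<in> Z1" "w = I z" using Z2(3) by blast
  have zZ: "z \<in> Z" using z(1) Z1(3) by blast
  have z0: "norm z > 0" using w(2) z(2) by (auto simp: I.zero)
  define e where "e = path s z"
  have e: "e = (2 - s) *\<^sub>R I z + s *\<^sub>R J z" and ne: "norm e \<le> \<delta> * norm z"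
    using Z_small[OF zZ] \<phi>_Z[OF zZ] by (simp_all add: e_def path_def Q_def P_id)
  have \<phi>e: "\<phi> e = 0" by (simp add: e \<phi>.add \<phi>.scaleR \<phi>_Z[OF zZ] \<phi>_J)
  have "2 *\<^sub>R w = e + s *\<^sub>R ?T z" by (simp add: e z(2) algebra_simps flip: scaleR_2)
  then have "2 * norm w \<le> norm e + s * norm (?T z)"
    using norm_triangle_ineq[of e "s *\<^sub>R ?T z"] norm_scaleR[of 2 w] s by simp
  also have "\<dots> \<le> \<delta> * norm z + s * (\<epsilon> * norm z)"
    using ne Z1_small[OF z(1)] s by (intro add_mono mult_left_mono)
  finally have w_le: "2 * norm w \<le> (\<delta> + s * \<epsilon>) * norm z" by (simp add: algebra_simps)
  \<comment> \<open>Applying \<open>J\<close> to the error \<open>e\<close> turns the relation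
    between \<open>I z\<close> and \<open>J z\<close> into one between \<open>J w\<close> and
    \<open>z\<close>, which expresses \<open>2 *\<^sub>R z\<close> through
    \<open>I w - J w\<close>.\<close>
  have Je: "J e = (2 - s) *\<^sub>R J w - s *\<^sub>R z"
    using \<phi>_Z[OF zZ] by (simp add: e z(2) J_add J_scale \<phi>.scaleR \<phi>_J JJ)
  have "2 *\<^sub>R z = - J e - (2 - s) *\<^sub>R ?T w" by (simp add: Je z(2) II algebra_simps flip: scaleR_2)
  then have "2 * norm z \<le> norm (J e) + (2 - s) * norm (?T w)"
    using norm_triangle_ineq4[of "- J e" "(2 - s) *\<^sub>R ?T w"] norm_scaleR[of 2 z] s by simp
  also have "\<dots> \<le> M * (\<delta> * norm z) + (2 - s) * (\<epsilon> * norm w)"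
  proof (intro add_mono mult_left_mono)
    show "norm (J e) \<le> M * (\<delta> * norm z)"
      using M[OF \<phi>e] mult_left_mono[OF ne M_pos] by linarith
  qed (use Z2_small[OF w(1)] s in auto)
  finally have "4 * norm z \<le> 2 * M * \<delta> * norm z + (2 - s) * \<epsilon> * (2 * norm w)" by simp
  also have "\<dots> \<le> 2 * M * \<delta> * norm z + (2 - s) * \<epsilon> * ((\<delta> + s * \<epsilon>) * norm z)"
    using w_le s \<epsilon> by (intro add_left_mono mult_left_mono) auto
  also have "\<dots> = (2 * M * \<delta> + (2 - s) * \<epsilon> * \<delta> + (s * (2 - s)) * \<epsilon>\<^sup>2) * norm z"
    by (simp add: algebra_simps power2_eq_square)
  finally have "4 \<le> 2 * M * \<delta> + (2 - s) * \<epsilon> * \<delta> + (s * (2 - s)) * \<epsilon>\<^sup>2" using z0 by simp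
  also have "\<dots> \<le> 2 * M * \<delta> + 2 * \<epsilon> * \<delta> + 1 * \<epsilon>\<^sup>2"
  proof (intro add_mono mult_right_mono order_refl)
    show "s * (2 - s) \<le> 1" using zero_le_square[of "1 - s"] by (simp add: algebra_simps)
  qed (use s \<epsilon> \<delta> M_pos in auto)
  also have "\<dots> = 2 * (\<epsilon> + M) * \<delta> + \<epsilon>\<^sup>2" by (simp add: algebra_simps)
  also have "2 * (\<epsilon> + M) * \<delta> = (4 - \<epsilon>\<^sup>2) / 2"
  proof -
    have "\<epsilon> + M \<noteq> 0" using \<epsilon>(1) M_pos by linarith
    then have "(\<epsilon> + M) * \<delta> = (4 - \<epsilon>\<^sup>2) / 4"
      by (metis \<delta>_def nonzero_mult_div_cancel_left times_divide_eq_right)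
    then show ?thesis by (simp only: mult.assoc)
  qed
  finally show False using \<epsilon>2 by (simp add: field_simps)
qed

text \<open>Restoring the missing value at \<open>v\<close> by a rank one map gives 2 I, which is
  invertible.\<close>

lemma index_zero_path_0: "index_zero (path 0)"
proof -
  let ?K = "\<lambda>x. \<phi> x *\<^sub>R (2 *\<^sub>R I v)"
  have eq: "path 0 x + ?K x = 2 *\<^sub>R I x" for x
    by (simp add: path_def P_def I.diff I.scaleR algebra_simps)
  obtain N where N: "N > 0" "\<And>x. norm (I x) \<le> norm x * N" using I.pos_bounded by blast
  have "2 / N * norm x \<le> norm (path 0 x + ?K x)" for x
    unfolding eq using N(2)[of "I x"] N(1) by (simp add: II field_simps)
  moreover have "surj (\<lambda>x. path 0 x + ?K x)"
    unfolding eq by (rule surjI[of _ "\<lambda>y. - (I y /\<^sub>R 2)"]) (simp add: I.neg I.scaleR II)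
  moreover have "bounded_linear ?K" by (rule bounded_linear_compose[OF bounded_linear_scaleR_left \<phi>])
  moreover have "finite_rank ?K" by (rule finite_rank_rank_one[OF \<phi>.linear])
  moreover have "2 / N > 0" using N(1) by simp
  ultimately show ?thesis unfolding index_zero_def by blast
qed

text \<open>The path is Lipschitz in \<open>s\<close> with constant \<open>N\<close>, so index zero
  is a locally constant property on the connected interval.\<close>

lemma index_zero_path_1:
  assumes usf: "\<And>s. 0 \<le> s \<Longrightarrow> s \<le> 1 \<Longrightarrow> upper_semi_fredholm (path s)"
  shows "index_zero (path 1)"
proof -
  obtain N where N: "N > 0" "\<And>x. norm (Q x - I (P x)) \<le> norm x * N"
    using bounded_linear.pos_bounded[OF bounded_linear_sub[OF bounded_linear_Q bounded_linear_IP]] by blast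
  have "index_zero (path 0) = index_zero (path 1)"
  proof (rule connected_local_const[of "{0..1::real}" _ _ "\<lambda>s. index_zero (path s)"])
    show "\<forall>s\<in>{0..1}. \<forall>\<^sub>F t in at s within {0..1}. index_zero (path s) = index_zero (path t)"
    proof
      fix s :: real assume "s \<in> {0..1}"
      then have "upper_semi_fredholm (path s)" using usf by simp
      then obtain r where r: "r > 0" "\<And>B. bounded_linear B \<Longrightarrow> (\<And>x. norm (B x - path s x) \<le> r * norm x) \<Longrightarrow>
          index_zero B \<longleftrightarrow> index_zero (path s)"
        using index_zero_locally_constant[OF bounded_linear_path] by blast
      have "index_zero (path s) = index_zero (path t)" if t: "dist t s < r / N" for t
      proof (intro r(2)[OF bounded_linear_path, symmetric])
        fix x
        have "path t x - path s x = (t - s) *\<^sub>R (Q x - I (P x))"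
          by (simp add: path_def algebra_simps)
        then have "norm (path t x - path s x) \<le> dist t s * (norm x * N)"
          using N(2)[of x] by (simp add: dist_real_def mult_left_mono)
        also have "\<dots> \<le> r / N * (norm x * N)" using t N(1) by (intro mult_right_mono) auto
        finally show "norm (path t x - path s x) \<le> r * norm x" using N(1) by simp
      qed
      then show "\<forall>\<^sub>F t in at s within {0..1}. index_zero (path s) = index_zero (path t)"
        unfolding eventually_at using r(1) N(1) by (intro exI[of _ "r / N"]) auto
    qed
  qed auto
  then show ?thesis using index_zero_path_0 by simp
qed

text \<open>\<open>path 1\<close> kills \<open>v\<close> and intertwines \<open>Q\<close> with
  \<open>I\<close>. Where the functionals separating \<open>K\<close> vanish it agrees with the
  bounded below \<open>path 1 + K\<close>, so its kernel is trivial there and the parity argument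
  applies.\<close>

lemma not_index_zero_path_1: "\<not> index_zero (path 1)"
proof
  assume zero: "index_zero (path 1)"
  then obtain K c where K: "bounded_linear K" "finite_rank K" "c > 0"
    "\<And>x. c * norm x \<le> norm (path 1 x + K x)" by (auto simp: index_zero_def)
  interpret complex_hyperplane I Q \<phi> v
  proof
    show "Q (Q x) = \<phi> x *\<^sub>R v - x" for x
      using \<phi>_P by (simp add: Q_def P_id \<phi>_J JJ) (simp add: P_def)
  qed (use II \<phi>_v \<phi>_P \<phi>_J in \<open>auto simp: Q_def I.add I.scaleR \<phi>.add \<phi>.scaleR
      linear_simps[OF bounded_linear_Q, unfolded Q_def]\<close>)
  obtain G where G: "finite G" "\<And>g. g \<in> G \<Longrightarrow> linear (g :: 'a \<Rightarrow> real)"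
    "\<And>x. (\<And>g. g \<in> G \<Longrightarrow> g x = 0) \<Longrightarrow> K x = 0"
    using finite_rank_separating_functionals[OF K(2)] by blast
  show False
  proof (rule complex_index_contradiction[OF G(1,2), of "path 1"])
    show "linear (path 1)" using bounded_linear_path by (rule bounded_linear.linear)
    show "path 1 v = 0" by (simp add: path_def Q_v) (simp add: P_def \<phi>_v I.zero)
    show "path 1 (Q x) = I (path 1 x)" for x
      by (simp add: path_def P_id \<phi>_Q QQ I.add II) (simp add: P_def algebra_simps)
    show "x = 0" if "path 1 x = 0" "\<And>g. g \<in> G \<Longrightarrow> g x = 0" for x
    proof -
      have "c * norm x \<le> 0" using K(4)[of x] G(3)[of x] that by simp
      then show ?thesis using K(3) by (simp add: mult_le_0_iff)
    qed
    show "inj (\<lambda>x. path 1 x + K x) \<longleftrightarrow> surj (\<lambda>x. path 1 x + K x)" if "finite_rank K" for K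
      by (rule index_zero_inj_iff_surj[OF bounded_linear_path zero that])
  qed auto
qed

end

theorem theorem1p6:
  fixes I J :: "'a::banach \<Rightarrow> 'a" and H :: "'a set"
  assumes "complex_structure UNIV I"
    and "hyperplane H"
    and "complex_structure H J"
  shows "S_seminorm H (\<lambda>x. I x - J x) \<ge> 2"
proof (rule ccontr)
  obtain \<phi> :: "'a \<Rightarrow> real" and v where \<phi>: "bounded_linear \<phi>" "\<phi> v = 1" and H: "H = {x. \<phi> x = 0}"
    using hyperplane_functional[OF assms(2)] by blast
  interpret complex_structure_pair I J \<phi> v
    using assms(1,3) \<phi> H by (simp add: complex_structure_pair_def)
  let ?E = "{\<epsilon>. \<epsilon> > 0 \<and> S_admissible H (\<lambda>x. I x - J x) \<epsilon>}"
  assume "\<not> S_seminorm H (\<lambda>x. I x - J x) \<ge> 2"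
  then have "Inf ?E < 2" by (simp add: S_seminorm_def)
  \<comment> \<open>Nonemptiness is what turns the bound on the infimum into an actual admissible
    value below 2.\<close>
  moreover have "?E \<noteq> {}"
    using S_admissible_exists[OF bounded_linear_on_difference] by (auto simp: H)
  ultimately obtain \<epsilon> where "\<epsilon> > 0" "\<epsilon> < 2" "S_admissible H (\<lambda>x. I x - J x) \<epsilon>"
    using cInf_lessD[of ?E 2] by auto
  then have "index_zero (path 1)"
    by (intro index_zero_path_1 upper_semi_fredholm_path) (auto simp: H)
  then show False using not_index_zero_path_1 by blast
qed

end
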